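(* Let $3\le D<n$ be integers, where $D$ is odd. There exists a class $\mathcal T$ of trees $T$ with size $\Theta(n)$, diameter $D$ and $\xi(T)\le D-2$, such that every leader election algorithm with advice working in time $D-2$ on the class $\mathcal T$ requires advice of size $\Omega(\log n)$. (The constants implied by $\Theta$ and $\Omega$ are absolute; the lower bound is asymptotic, i.e., for sufficiently large $n$.)
   Context: Trees are finite, undirected and anonymous (nodes have no labels), and are port-numbered: at each node $v$ of degree $d$ the incident edges carry distinct port numbers from $\{0,\dots,d-1\}$; there is no relation between the two port numbers of an edge at its two endpoints. The size of a tree is its number of nodes. Leader election in $T$: every node $v$ must output a finite sequence $P(v)=(p_1,\dots,p_k)$ of nonnegative integers (possibly empty). Let $P^*(v)$ be the path starting at $v$ obtained by taking $p_i$ as the outgoing port at the $i$-th node of the path. All $P^*(v)$ must be simple paths in $T$ ending at one common node (the leader). View: $V_T(v,r)$ is the subtree of $T$ induced by all nodes at distance at most $r$ from $v$, rooted at $v$, with all port numbers at these nodes and with the degrees of all nodes at distance exactly $r$ from $v$ (views are identified up to root- and port-preserving isomorphism). Deterministic algorithm with advice (LOCAL model): an oracle knowing $T$ assigns to $T$ one binary string $A(T)$, given to all nodes at the start; the size of advice for $T$ is the length of $A(T)$. After each round $r\ge 0$, each node $v$ that has not yet halted decides, as a function of $V_T(v,r)$ and $A(T)$ only, whether to halt and what to output. The algorithm works in time $\tau$ on a class if it solves leader election in every tree of the class with all nodes halting in rounds at most $\tau$. It "requires advice of size $\Omega(L)$" on the class if $\max_{T\in\mathcal T}|A(T)|\in\Omega(L)$.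 All algorithms are deterministic. $\xi(T)$ is the minimum time in which leader election in $T$ is feasible when each node is given the entire port-numbered map of $T$ (without its own position marked), i.e., the smallest $\tau\ge 0$ for which there is a valid assignment of outputs in $T$ in which the output of each node $v$ depends only on $V_T(v,\tau)$. *)

theory Defs
  imports
    Complex_Main
    "HOL-Library.Extended_Nat"
    "HOL-Library.FuncSet"
    "Graph_Theory.Graph_Theory"
begin

text \<open>
  An undirected graph is a symmetric digraph; the arc \<open>(u, v)\<close> is the end at \<open>u\<close> of the edge
  \<open>{u, v}\<close>, and \<open>port T (u, v)\<close> is the number of that edge at \<open>u\<close>.  Vertex names only serve to
  write a graph down: algorithms never have access to them (see \<open>respects_views\<close>).
\<close>

record 'a port_graph =
  graph :: "'a pair_pre_digraph"
  port :: "'a \<times> 'a \<Rightarrow> nat"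

abbreviation nodes :: "'a port_graph \<Rightarrow> 'a set" where
  "nodes T \<equiv> pverts (graph T)"

abbreviation degree :: "'a port_graph \<Rightarrow> 'a \<Rightarrow> nat" where
  "degree T v \<equiv> out_degree (with_proj (graph T)) v"

text \<open>
  The library's \<open>tree\<close> forbids all directed cycles, hence also the closed walk \<open>u, v, u\<close> along a
  single undirected edge.  Cycles of an undirected graph have length at least 3.
\<close>

definition undirected_tree :: "'a pair_pre_digraph \<Rightarrow> bool" where
  "undirected_tree G \<longleftrightarrow>
     pair_graph G \<and> Digraph_Component.connected (with_proj G) \<and>
     (\<nexists>p. pre_digraph.cycle (with_proj G) p \<and> length p \<ge> 3)"

definition port_tree :: "'a port_graph \<Rightarrow> bool" where
  "port_tree T \<longleftrightarrow>
     undirected_tree (graph T) \<and>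
     (\<forall>v\<in>nodes T. bij_betw (port T) (out_arcs (with_proj (graph T)) v) {0..<degree T v})"

definition distance :: "'a port_graph \<Rightarrow> 'a \<Rightarrow> 'a \<Rightarrow> nat" where
  "distance T u v =
     (LEAST k. \<exists>p. vwalk p (with_proj (graph T)) \<and> hd p = u \<and> last p = v \<and> vwalk_length p = k)"

definition diameter :: "'a port_graph \<Rightarrow> nat" where
  "diameter T = Max ((\<lambda>(u, v). distance T u v) ` (nodes T \<times> nodes T))"

text \<open>
  \<open>valid_election T out\<close>: in \<open>T\<close>, the output \<open>out v\<close> of each node \<open>v\<close> is the sequence of outgoing
  ports of a simple path \<open>p\<close> from \<open>v\<close> to a common leader.  As ports at a node are distinct, at most
  one walk from \<open>v\<close> has a given sequence of outgoing ports.
\<close>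

definition valid_election :: "'a port_graph \<Rightarrow> ('a \<Rightarrow> nat list) \<Rightarrow> bool" where
  "valid_election T out \<longleftrightarrow>
     (\<exists>leader\<in>nodes T. \<forall>v\<in>nodes T. \<exists>p.
        vpath p (with_proj (graph T)) \<and> hd p = v \<and> map (port T) (vwalk_arcs p) = out v \<and>
        last p = leader)"

text \<open>
  \<open>frontier_degree\<close> is defined exactly at the nodes at distance \<open>r\<close> from the root of a view of
  radius \<open>r\<close>; the ports of arcs leaving the view are determined by it.
\<close>

record 'a view =
  view_graph :: "'a port_graph"
  root :: 'a
  frontier_degree :: "'a \<Rightarrow> nat option"

definition view_at :: "'a port_graph \<Rightarrow> 'a \<Rightarrow> nat \<Rightarrow> 'a view" where
  "view_at T v r =
     (let B = {u \<in> nodes T. distance T v u \<le> r};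
          E = parcs (graph T) \<inter> B \<times> B
      in \<lparr> view_graph = \<lparr> graph = \<lparr> pverts = B, parcs = E \<rparr>, port = restrict (port T) E \<rparr>,
           root = v,
           frontier_degree =
             (\<lambda>u. if u \<in> B \<and> distance T v u = r then Some (degree T u) else None) \<rparr>)"

definition view_iso :: "'a view \<Rightarrow> 'b view \<Rightarrow> bool" where
  "view_iso V W \<longleftrightarrow>
     (\<exists>f. bij_betw f (nodes (view_graph V)) (nodes (view_graph W)) \<and>
          f (root V) = root W \<and>
          (\<forall>x\<in>nodes (view_graph V). \<forall>y\<in>nodes (view_graph V).
             (x, y) \<in> parcs (graph (view_graph V)) \<longleftrightarrow>
             (f x, f y) \<in> parcs (graph (view_graph W))) \<and>
          (\<forall>(x, y)\<in>parcs (graph (view_graph V)).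
             port (view_graph W) (f x, f y) = port (view_graph V) (x, y)) \<and>
          (\<forall>x\<in>nodes (view_graph V). frontier_degree W (f x) = frontier_degree V x))"

definition solvable_with_map :: "'a port_graph \<Rightarrow> nat \<Rightarrow> bool" where
  "solvable_with_map T \<tau> \<longleftrightarrow>
     (\<exists>out. valid_election T out \<and>
        (\<forall>u\<in>nodes T. \<forall>v\<in>nodes T.
           view_iso (view_at T u \<tau>) (view_at T v \<tau>) \<longrightarrow> out u = out v))"

text \<open>The infimum is \<open>\<infinity>\<close> if leader election in \<open>T\<close> is infeasible even with a map.\<close>

definition xi :: "'a port_graph \<Rightarrow> enat" where
  "xi T = (INF \<tau>\<in>{\<tau>. solvable_with_map T \<tau>}. enat \<tau>)"

text \<open>
  An algorithm maps a view and the advice to \<open>Some\<close> output (halt) or \<open>None\<close> (continue).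
  \<open>respects_views\<close> expresses that views are identified up to isomorphism.
\<close>

type_synonym 'a algorithm = "'a view \<Rightarrow> bool list \<Rightarrow> nat list option"

definition respects_views :: "'a algorithm \<Rightarrow> bool" where
  "respects_views alg \<longleftrightarrow>
     (\<forall>T T' v v' r r' a.
        port_tree T \<and> port_tree T' \<and> v \<in> nodes T \<and> v' \<in> nodes T' \<and>
        view_iso (view_at T v r) (view_at T' v' r') \<longrightarrow>
        alg (view_at T v r) a = alg (view_at T' v' r') a)"

definition halts_at :: "'a algorithm \<Rightarrow> bool list \<Rightarrow> 'a port_graph \<Rightarrow> 'a \<Rightarrow> nat \<Rightarrow> bool" where
  "halts_at alg a T v r \<longleftrightarrow>
     alg (view_at T v r) a \<noteq> None \<and> (\<forall>r'<r. alg (view_at T v r') a = None)"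

definition elects_in_time ::
    "('a port_graph \<Rightarrow> bool list) \<Rightarrow> 'a algorithm \<Rightarrow> nat \<Rightarrow> 'a port_graph set \<Rightarrow> bool" where
  "elects_in_time advice alg \<tau> \<T> \<longleftrightarrow>
     respects_views alg \<and>
     (\<forall>T\<in>\<T>. \<exists>out. valid_election T out \<and>
        (\<forall>v\<in>nodes T. \<exists>r\<le>\<tau>.
           halts_at alg (advice T) T v r \<and> alg (view_at T v r) (advice T) = Some (out v)))"

end

theory Submission
  imports Defs "HOL-Library.Countable" "HOL-Combinatorics.Transposition"
begin

text \<open>
  All trees of a class share one underlying graph, a double broom: two mirrored handles joined by a
  central edge, each fanning out into about \<open>n\<close> equally long tines.  Only the port numbers vary.

  For \<open>D \<ge> 5\<close> the tines have length 2, and a set \<open>S \<subseteq> {..<n}\<close> is written on each side by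
  swapping the two ports at the middle node of the tines in \<open>S\<close>.  In time \<open>D - 2\<close> the end of a
  tine learns the set of its own side, but nothing about the set of the other side.  Hence for
  each piece of advice \<open>a\<close>, whether the path output at that end crosses the central edge depends
  only on \<open>a\<close> and on the own set.  If the two sets differ, exactly one side crosses, so \<open>S\<close> is
  determined by the set of all \<open>a\<close> under which it does not cross.  This forces
  \<open>2 ^ n \<le> 2 ^ A\<close> for the number \<open>A\<close> of pieces of advice.  With a map, every node recognises
  its position, because the two sets differ.

  For \<open>D = 3\<close> the broom is a double star whose centers have different degrees, and the central
  edge has the same port \<open>p\<close> at both centers.  In time 1 most leaves cannot see \<open>p\<close>, while on the
  side without the leader they have to output it.  So all values of \<open>p\<close> need different advice.
\<close>

section \<open>Trees from a rank function\<close>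

lemma mk_symmetric_arcs:
  assumes "sym (parcs G)"
  shows "parcs (mk_symmetric (with_proj G)) = parcs G"
  using assms by (auto simp: mk_symmetric_def sym_def)

text \<open>Descending in rank connects every node to \<open>apex\<close>. On a cycle, a node of
  maximal rank would have two different neighbours of no larger rank, which \<open>unique\<close>
  excludes.\<close>

lemma undirected_treeI:
  fixes G :: "'a pair_pre_digraph" and rank :: "'a \<Rightarrow> nat"
  assumes fin: "finite (pverts G)" and sub: "parcs G \<subseteq> pverts G \<times> pverts G"
    and sym: "sym (parcs G)" and irr: "\<And>u. (u, u) \<notin> parcs G" and apex: "apex \<in> pverts G"
    and down: "\<And>v. v \<in> pverts G \<Longrightarrow> v \<noteq> apex \<Longrightarrow> \<exists>w. (v, w) \<in> parcs G \<and> rank w < rank v"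
    and unique: "\<And>u v w. (u, v) \<in> parcs G \<Longrightarrow> (u, w) \<in> parcs G \<Longrightarrow>
      rank v \<le> rank u \<Longrightarrow> rank w \<le> rank u \<Longrightarrow> v = w"
  shows "undirected_tree G"
proof -
  have pg: "pair_graph G"
    using sub fin sym irr
    by unfold_locales (auto simp: symmetric_def intro: finite_subset)
  interpret pair_graph G by (fact pg)
  have to_root: "v \<rightarrow>\<^sup>*\<^bsub>G\<^esub> apex" if "v \<in> pverts G" for v
    using that
  proof (induction "rank v" arbitrary: v rule: less_induct)
    case less
    show ?case
    proof (cases "v = apex")
      case True
      then show ?thesis using less.prems by simp
    next
      case False
      then obtain w where w: "(v, w) \<in> parcs G" "rank w < rank v"
        using down less.prems by blast
      then have "w \<rightarrow>\<^sup>*\<^bsub>G\<^esub> apex" using less.hyps sub by blast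
      then show ?thesis using w by (auto intro: adj_reachable_trans)
    qed
  qed
  have conn: "Digraph_Component.connected (with_proj G)"
    unfolding connected_def
  proof (rule strongly_connectedI)
    show "verts (with_proj (mk_symmetric (with_proj G))) \<noteq> {}"
      using apex by (auto simp: mk_symmetric_def)
    fix u v
    assume uv: "u \<in> verts (with_proj (mk_symmetric (with_proj G)))"
      "v \<in> verts (with_proj (mk_symmetric (with_proj G)))"
    have eq: "mk_symmetric (with_proj G) = G"
      using mk_symmetric_arcs[OF sym] by (simp add: mk_symmetric_def)
    have "u \<rightarrow>\<^sup>*\<^bsub>G\<^esub> apex" "v \<rightarrow>\<^sup>*\<^bsub>G\<^esub> apex"
      using uv to_root by (auto simp: mk_symmetric_def)
    then have "u \<rightarrow>\<^sup>*\<^bsub>G\<^esub> v"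
      by (meson reachable_trans symmetric_reachable sym_arcs)
    then show "u \<rightarrow>\<^sup>*\<^bsub>with_proj (mk_symmetric (with_proj G))\<^esub> v" by (simp add: eq)
  qed
  have "length p < 3" if cyc: "cycle p" for p
  proof (rule ccontr)
    assume len: "\<not> length p < 3"
    obtain u where walk: "awalk u p u" and dist: "distinct (tl (pawalk_verts u p))"
      using cyc unfolding cycle_def by auto
    define n where "n = length p"
    have n: "n \<ge> 3" using len by (simp add: n_def)
    define f where "f i = fst (p ! i)" for i
    have pv: "pawalk_verts u p = map fst p @ [snd (last p)]"
      using n awalk_verts_conv[of u p] by (auto simp: n_def)
    have pv': "pawalk_verts u p = u # map snd p"
      using walk awalk_verts_conv'[of u p u] n unfolding awalk_def
      by (cases p) (auto simp: n_def)
    have arc: "(f i, f (Suc i mod n)) \<in> parcs G" if "i < n" for i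
    proof -
      have "p ! i \<in> parcs G" using walk that unfolding awalk_def n_def by auto
      moreover have "snd (p ! i) = f (Suc i mod n)"
      proof (cases "Suc i < n")
        case True
        have "(u # map snd p) ! Suc i = (map fst p @ [snd (last p)]) ! Suc i"
          using pv pv' by simp
        then show ?thesis using True that by (simp add: n_def nth_append f_def)
      next
        case False
        then have i: "Suc i = n" using that by simp
        then have p: "p \<noteq> []" "i = length p - 1" using n by (auto simp: n_def)
        then have "p ! i = last p" by (simp add: last_conv_nth)
        moreover have "(u # map snd p) ! 0 = (map fst p @ [snd (last p)]) ! 0"
          using pv pv' by simp
        moreover have "snd (last p) = u"
          using walk by (metis awalkE last_snoc pv)
        ultimately show ?thesis using i n p(1) by (auto simp: n_def nth_append f_def)
      qed
      ultimately show ?thesis unfolding f_def by (metis prod.collapse)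
    qed
    have inj: "inj_on f {..<n}"
    proof -
      \<comment> \<open>\<open>cycle\<close> gives distinctness of the heads of the arcs, while
        \<open>f\<close> lists the tails; on a closed walk the two lists agree as multisets.\<close>
      have "mset (map fst p) = mset (map snd p)"
      proof -
        have "map fst p @ [snd (last p)] = u # map snd p" using pv pv' by simp
        then have "mset (map fst p @ [snd (last p)]) = mset (u # map snd p)" by simp
        moreover have "snd (last p) = u" using walk by (metis awalkE last_snoc pv)
        ultimately show ?thesis by simp
      qed
      then have "distinct (map fst p)" using dist pv' mset_eq_imp_distinct_iff by fastforce
      then show ?thesis
        by (auto simp: f_def n_def inj_on_def distinct_conv_nth)
    qed
    obtain j where j: "j < n" "\<And>i. i < n \<Longrightarrow> rank (f i) \<le> rank (f j)"
    proof -
      have "finite ((\<lambda>i. rank (f i)) ` {..<n})" "(\<lambda>i. rank (f i)) ` {..<n} \<noteq> {}"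
        using n by (auto simp: lessThan_empty_iff)
      then have "Max ((\<lambda>i. rank (f i)) ` {..<n}) \<in> (\<lambda>i. rank (f i)) ` {..<n}" by (rule Max_in)
      then obtain j where "j < n" "rank (f j) = Max ((\<lambda>i. rank (f i)) ` {..<n})" by auto
      then show ?thesis using that by simp
    qed
    \<comment> \<open>The cyclic predecessor of the node \<open>f j\<close> of maximal rank. By
      \<open>unique\<close> it coincides with the successor, which is impossible for
      \<open>n \<ge> 3\<close>.\<close>
    define i where "i = (if j = 0 then n - 1 else j - 1)"
    have i: "i < n" "Suc i mod n = j" using j n by (auto simp: i_def)
    have "(f j, f i) \<in> parcs G" using arc[OF i(1)] i(2) sym by (metis symD)
    then have "f i = f (Suc j mod n)"
      using unique[OF _ arc[OF j(1)]] j i(1) n by simp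
    then have "i = Suc j mod n" using inj i n by (auto simp: inj_on_def)
    then show False using j n by (auto simp: i_def mod_Suc split: if_splits)
  qed
  then show ?thesis using pg conn unfolding undirected_tree_def by (metis leD)
qed

text \<open>Following \<open>step\<close> downhill gives a walk of length \<open>d x\<close>; since
  \<open>d\<close> drops by at most one per arc, no walk to \<open>v\<close> is shorter.\<close>

lemma distance_eqI:
  fixes d :: "'a \<Rightarrow> nat"
  assumes sub: "parcs (graph T) \<subseteq> nodes T \<times> nodes T"
    and v: "v \<in> nodes T" and zero: "\<And>x. x \<in> nodes T \<Longrightarrow> d x = 0 \<longleftrightarrow> x = v"
    and step: "\<And>x. x \<in> nodes T \<Longrightarrow> x \<noteq> v \<Longrightarrow> \<exists>w. (x, w) \<in> parcs (graph T) \<and> d x = Suc (d w)"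
    and lip: "\<And>x w. (x, w) \<in> parcs (graph T) \<Longrightarrow> d x \<le> Suc (d w)"
    and x: "x \<in> nodes T"
  shows "distance T x v = d x"
  unfolding distance_def
proof (rule Least_equality)
  show "\<exists>p. vwalk p (with_proj (graph T)) \<and> hd p = x \<and> last p = v \<and> vwalk_length p = d x"
    using x
  proof (induction "d x" arbitrary: x)
    case 0
    then have "x = v" using zero by simp
    then show ?case using 0 by (intro exI[of _ "[x]"]) auto
  next
    case (Suc m)
    then obtain w where w: "(x, w) \<in> parcs (graph T)" "d x = Suc (d w)"
      using zero step by (metis nat.distinct(1))
    then obtain p where p: "vwalk p (with_proj (graph T))" "hd p = w" "last p = v"
      "vwalk_length p = d w"
      using Suc sub by (metis SigmaD2 nat.inject subsetD)
    have ne: "p \<noteq> []" using p(1) by auto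
    then have "length p = Suc (d w)" using p(4) by (cases p) auto
    then show ?case
      using p w Suc.prems ne by (intro exI[of _ "x # p"]) (auto intro: vwalk_consI)
  qed
next
  fix k
  assume "\<exists>p. vwalk p (with_proj (graph T)) \<and> hd p = x \<and> last p = v \<and> vwalk_length p = k"
  then obtain p where p: "vwalk p (with_proj (graph T))" "hd p = x" "last p = v"
    "vwalk_length p = k" by blast
  have "last p = v \<longrightarrow> d (hd p) \<le> length p - 1"
    using p(1)
  proof (induction rule: vwalk_induct)
    case (Base u)
    then show ?case using zero by auto
  next
    case (Cons u w es)
    then show ?case using lip[of u w] by fastforce
  qed
  then show "d x \<le> k" using p by simp
qed

section \<open>Double brooms\<close>

text \<open>Coordinates are packed into one number because the classes consist of graphs over
  \<open>nat\<close>.\<close>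

definition vx :: "bool \<Rightarrow> nat \<Rightarrow> nat \<Rightarrow> nat" where
  "vx s l i = to_nat (s, l, i)"

definition coords :: "nat \<Rightarrow> bool \<times> nat \<times> nat" where
  "coords = from_nat"

lemma coords_vx [simp]: "coords (vx s l i) = (s, l, i)"
  by (simp add: coords_def vx_def)

lemma vx_eq_iff [simp]: "vx s l i = vx t m j \<longleftrightarrow> s = t \<and> l = m \<and> i = j"
  by (simp add: vx_def)

text \<open>
  The node \<open>vx s l i\<close> lies on side \<open>s\<close> at distance \<open>l\<close> from the end of the central edge on that
  side.  Levels up to \<open>b\<close> form the handle, with \<open>i = 0\<close>; above them \<open>i\<close> numbers the tines.
\<close>

locale double_broom =
  fixes b h :: nat and k :: "bool \<Rightarrow> nat"
  assumes b_less_h: "b < h" and k_pos: "0 < k s"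
begin

definition is_node :: "bool \<Rightarrow> nat \<Rightarrow> nat \<Rightarrow> bool" where
  "is_node s l i \<longleftrightarrow> l \<le> h \<and> i < (if l \<le> b then 1 else k s)"

text \<open>The index may change along an edge only at the fork, the single node of level
  \<open>b\<close> on its side, where all tines start.\<close>

definition is_edge :: "bool \<Rightarrow> nat \<Rightarrow> nat \<Rightarrow> bool \<Rightarrow> nat \<Rightarrow> nat \<Rightarrow> bool" where
  "is_edge s l i t m j \<longleftrightarrow>
     s \<noteq> t \<and> l = 0 \<and> m = 0 \<or>
     s = t \<and> (m = Suc l \<and> (i = j \<or> l = b) \<or> l = Suc m \<and> (i = j \<or> m = b))"

definition broom :: "nat pair_pre_digraph" where
  "broom =
     \<lparr> pverts = {vx s l i | s l i. is_node s l i},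
       parcs = {(vx s l i, vx t m j) | s l i t m j.
         is_node s l i \<and> is_node t m j \<and> is_edge s l i t m j} \<rparr>"

definition children :: "bool \<Rightarrow> nat \<Rightarrow> nat" where
  "children s l = (if l = b then k s else if l < h then 1 else 0)"

text \<open>
  The unpermuted port of a node is the child's index, or the number of children for the edge
  towards the other side; \<open>\<phi> s l i\<close> permutes the ports of the node \<open>vx s l i\<close>.
\<close>

definition ported :: "(bool \<Rightarrow> nat \<Rightarrow> nat \<Rightarrow> nat \<Rightarrow> nat) \<Rightarrow> nat port_graph" where
  "ported \<phi> =
     \<lparr> graph = broom,
       port = (\<lambda>(u, v). case coords u of (s, l, i) \<Rightarrow> case coords v of (t, m, j) \<Rightarrow>
         \<phi> s l i (if s = t \<and> m = Suc l then (if l = b then j else 0) else children s l)) \<rparr>"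

lemma graph_ported [simp]: "graph (ported \<phi>) = broom"
  by (simp add: ported_def)

lemma port_ported [simp]:
  "port (ported \<phi>) (vx s l i, vx t m j) =
     \<phi> s l i (if s = t \<and> m = Suc l then (if l = b then j else 0) else children s l)"
  by (simp add: ported_def)

lemma vx_in_verts [simp]: "vx s l i \<in> pverts broom \<longleftrightarrow> is_node s l i"
  by (auto simp: broom_def)

lemma vx_in_arcs [simp]:
  "(vx s l i, vx t m j) \<in> parcs broom \<longleftrightarrow>
     is_node s l i \<and> is_node t m j \<and> is_edge s l i t m j"
  by (auto simp: broom_def)

lemma in_vertsE:
  assumes "u \<in> pverts broom"
  obtains s l i where "u = vx s l i" "is_node s l i"
  using assms by (auto simp: broom_def)

lemma in_arcsE:
  assumes "(u, v) \<in> parcs broom"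
  obtains s l i t m j where "u = vx s l i" "v = vx t m j" "is_node s l i" "is_node t m j"
    "is_edge s l i t m j"
  using assms by (auto simp: broom_def)

lemma arcs_subset: "parcs broom \<subseteq> pverts broom \<times> pverts broom"
  by (auto elim!: in_arcsE)

lemma is_node_center [simp]: "is_node s 0 i \<longleftrightarrow> i = 0"
  by (auto simp: is_node_def)

section \<open>Size of a broom\<close>

lemma verts_eq:
  "pverts broom =
     (\<lambda>(s, l). vx s l 0) ` (UNIV \<times> {..b}) \<union>
     (\<Union>s. (\<lambda>(l, i). vx s l i) ` ({b<..h} \<times> {..<k s}))"
  (is "?L = ?R")
proof
  show "?L \<subseteq> ?R"
  proof
    fix x
    assume "x \<in> ?L"
    then obtain s l i where x: "x = vx s l i" "is_node s l i" by (rule in_vertsE)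
    show "x \<in> ?R"
    proof (cases "l \<le> b")
      case True
      then show ?thesis using x by (auto simp: is_node_def image_iff)
    next
      case False
      then show ?thesis using x by (auto simp: is_node_def image_iff)
    qed
  qed
  show "?R \<subseteq> ?L" using b_less_h by (auto simp: is_node_def)
qed

lemma finite_verts: "finite (pverts broom)"
  unfolding verts_eq by simp

lemma card_verts: "card (pverts broom) = 2 * Suc b + (h - b) * (k True + k False)"
proof -
  have inj: "inj_on (\<lambda>(s, l). vx s l 0) (UNIV \<times> {..b})"
    "inj_on (\<lambda>(l, i). vx s l i) ({b<..h} \<times> {..<k s})" for s
    by (auto simp: inj_on_def)
  have "card (\<Union>s. (\<lambda>(l, i). vx s l i) ` ({b<..h} \<times> {..<k s})) =
    (\<Sum>s\<in>UNIV. card ((\<lambda>(l, i). vx s l i) ` ({b<..h} \<times> {..<k s})))"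
    by (subst card_UN_disjoint) auto
  also have "\<dots> = (h - b) * (k True + k False)"
    by (simp add: card_image[OF inj(2)] UNIV_bool algebra_simps)
  finally have 1: "card (\<Union>s. (\<lambda>(l, i). vx s l i) ` ({b<..h} \<times> {..<k s})) =
    (h - b) * (k True + k False)" .
  have 2: "card ((\<lambda>(s, l). vx s l 0) ` (UNIV \<times> {..b})) = 2 * Suc b"
    by (simp add: card_image[OF inj(1)] card_cartesian_product)
  show ?thesis
    unfolding verts_eq 1[symmetric] 2[symmetric]
    by (rule card_Un_disjoint) auto
qed

section \<open>The broom is a tree\<close>

lemma sym_arcs: "sym (parcs broom)"
  by (auto intro!: symI elim!: in_arcsE simp: is_edge_def)

text \<open>The two centers are each other's parents. So every node, centers included, has exactly
  one parent, and its degree is \<open>Suc (children s l)\<close>.\<close>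

definition parent :: "bool \<Rightarrow> nat \<Rightarrow> nat \<Rightarrow> nat" where
  "parent s l i =
     (if l = 0 then vx (\<not> s) 0 0 else vx s (l - 1) (if l \<le> Suc b then 0 else i))"

lemma parent_in_arcs: "is_node s l i \<Longrightarrow> (vx s l i, parent s l i) \<in> parcs broom"
  using b_less_h by (auto simp: parent_def is_node_def is_edge_def split: if_splits)

lemma undirected_tree_broom: "undirected_tree broom"
\<comment> \<open>The rank is the distance to the center of side \<open>True\<close>; the shift by
  one on the other side orients the central edge.\<close>
proof (rule undirected_treeI[where apex = "vx True 0 0"
      and rank = "\<lambda>u. case coords u of (s, l, i) \<Rightarrow> if s then l else Suc l"])
  show "finite (pverts broom)" by (fact finite_verts)
  show "parcs broom \<subseteq> pverts broom \<times> pverts broom" by (fact arcs_subset)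
  show "sym (parcs broom)" by (fact sym_arcs)
  show "(u, u) \<notin> parcs broom" for u by (auto elim!: in_arcsE simp: is_edge_def)
  show "vx True 0 0 \<in> pverts broom" by simp
next
  fix v
  assume "v \<in> pverts broom" "v \<noteq> vx True 0 0"
  then obtain s l i where v: "v = vx s l i" "is_node s l i" "s \<longrightarrow> l \<noteq> 0"
    by (metis in_vertsE is_node_center)
  show "\<exists>w. (v, w) \<in> parcs broom \<and>
    (case coords w of (s, l, i) \<Rightarrow> if s then l else Suc l) <
    (case coords v of (s, l, i) \<Rightarrow> if s then l else Suc l)"
    using parent_in_arcs[OF v(2)] v
    by (intro exI[of _ "parent s l i"]) (auto simp: parent_def)
next
  fix u v w
  assume "(u, v) \<in> parcs broom" "(u, w) \<in> parcs broom"
    "(case coords v of (s, l, i) \<Rightarrow> if s then l else Suc l) \<le>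
     (case coords u of (s, l, i) \<Rightarrow> if s then l else Suc l)"
    "(case coords w of (s, l, i) \<Rightarrow> if s then l else Suc l) \<le>
     (case coords u of (s, l, i) \<Rightarrow> if s then l else Suc l)"
  then show "v = w"
    by (elim in_arcsE) (auto simp: is_edge_def is_node_def split: if_splits)
qed

section \<open>Port numberings of a broom\<close>

definition child :: "bool \<Rightarrow> nat \<Rightarrow> nat \<Rightarrow> nat \<Rightarrow> nat" where
  "child s l i c = vx s (Suc l) (if l < b then 0 else if l = b then c else i)"

lemma child_in_arcs:
  "is_node s l i \<Longrightarrow> c < children s l \<Longrightarrow> (vx s l i, child s l i c) \<in> parcs broom"
  using b_less_h
  by (auto simp: child_def is_node_def is_edge_def children_def split: if_splits)

lemma child_neq_parent: "child s l i c \<noteq> parent s l i"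
  "parent s l i \<noteq> child s l i c"
  by (auto simp: child_def parent_def)

lemma child_eq_iff:
  assumes "c < children s l" "d < children s l"
  shows "child s l i c = child s l i d \<longleftrightarrow> c = d"
  using assms by (auto simp: child_def children_def split: if_splits)

lemma port_parent [simp]: "port (ported \<phi>) (vx s l i, parent s l i) = \<phi> s l i (children s l)"
  by (auto simp: parent_def)

lemma port_child:
  "c < children s l \<Longrightarrow> port (ported \<phi>) (vx s l i, child s l i c) = \<phi> s l i c"
  by (auto simp: child_def children_def split: if_splits)

lemma arcs_from:
  assumes "(vx s l i, v) \<in> parcs broom"
  obtains "v = parent s l i" | c where "c < children s l" "v = child s l i c"
  using assms
proof (rule in_arcsE)
  fix s' l' i' t m j
  assume *: "vx s l i = vx s' l' i'" "v = vx t m j" "is_node s' l' i'" "is_node t m j"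
    "is_edge s' l' i' t m j"
  show thesis
  proof (cases "s = t \<and> m = Suc l")
    case True
    then show thesis
      using * that(2)[of "if l = b then j else 0"] b_less_h
      by (auto simp: children_def child_def is_node_def is_edge_def split: if_splits)
  next
    case False
    then show thesis
      using * that(1) b_less_h
      by (auto simp: parent_def is_node_def is_edge_def split: if_splits)
  qed
qed

definition permuted :: "(bool \<Rightarrow> nat \<Rightarrow> nat \<Rightarrow> nat \<Rightarrow> nat) \<Rightarrow> bool" where
  "permuted \<phi> \<longleftrightarrow> (\<forall>s l i. is_node s l i \<longrightarrow>
     bij_betw (\<phi> s l i) {0..<Suc (children s l)} {0..<Suc (children s l)})"

text \<open>The unpermuted ports enumerate the neighbours, first the children and then the parent.
  Composed with this enumeration the port function is just \<open>\<phi> s l i\<close>, so it is a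
  bijection because the other two are.\<close>

lemma bij_betw_ports:
  assumes "permuted \<phi>" "is_node s l i"
  shows "bij_betw (port (ported \<phi>)) (out_arcs (with_proj broom) (vx s l i))
    {0..<Suc (children s l)}"
proof -
  let ?nb = "\<lambda>c. if c < children s l then child s l i c else parent s l i"
  have "bij_betw (\<lambda>c. (vx s l i, ?nb c)) {0..<Suc (children s l)}
    (out_arcs (with_proj broom) (vx s l i))"
    unfolding bij_betw_def
  proof
    show "inj_on (\<lambda>c. (vx s l i, ?nb c)) {0..<Suc (children s l)}"
      by (auto simp: inj_on_def less_Suc_eq child_eq_iff child_neq_parent)
    show "(\<lambda>c. (vx s l i, ?nb c)) ` {0..<Suc (children s l)} =
      out_arcs (with_proj broom) (vx s l i)" (is "?L = ?R")
    proof
      show "?L \<subseteq> ?R"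
        using assms(2) by (auto simp: out_arcs_def parent_in_arcs child_in_arcs)
      show "?R \<subseteq> ?L"
      proof
        fix e
        assume "e \<in> ?R"
        then obtain v where e: "e = (vx s l i, v)" "(vx s l i, v) \<in> parcs broom"
          by (cases e) (auto simp: out_arcs_def)
        from e(2) show "e \<in> ?L"
        proof (cases rule: arcs_from)
          case 1
          then show ?thesis using e(1) by (intro image_eqI[of _ _ "children s l"]) auto
        next
          case (2 c)
          then show ?thesis using e(1) by (intro image_eqI[of _ _ c]) auto
        qed
      qed
    qed
  qed
  moreover have "bij_betw (port (ported \<phi>) \<circ> (\<lambda>c. (vx s l i, ?nb c)))
    {0..<Suc (children s l)} {0..<Suc (children s l)}"
  proof (rule bij_betw_cong[THEN iffD2])
    show "bij_betw (\<phi> s l i) {0..<Suc (children s l)} {0..<Suc (children s l)}"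
      using assms by (simp add: permuted_def)
    show "(port (ported \<phi>) \<circ> (\<lambda>c. (vx s l i, ?nb c))) c = \<phi> s l i c"
      if "c \<in> {0..<Suc (children s l)}" for c
      using that by (auto simp: port_child less_Suc_eq)
  qed
  ultimately show ?thesis
    using bij_betw_comp_iff by blast
qed

lemma degree_ported [simp]:
  assumes "is_node s l i"
  shows "out_degree (with_proj broom) (vx s l i) = Suc (children s l)"
proof -
  \<comment> \<open>Degrees do not depend on the ports, so they can be read off from the unpermuted
    numbering.\<close>
  have "permuted (\<lambda>_ _ _. id)" by (auto simp: permuted_def)
  from bij_betw_same_card[OF bij_betw_ports[OF this assms]]
  show ?thesis by (simp add: out_degree_def)
qed

lemma port_tree_ported:
  assumes "permuted \<phi>"
  shows "port_tree (ported \<phi>)"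
  unfolding port_tree_def
  using bij_betw_ports[OF assms]
  by (auto simp: undirected_tree_broom elim!: in_vertsE)

text \<open>With truncated subtraction \<open>(l - m) + (m - l)\<close> is the absolute difference.
  It applies when one node lies on the way from the other to the center of their side; different
  tines are joined through the fork at level \<open>b\<close>, opposite sides through the central
  edge.\<close>

definition bdist :: "nat \<Rightarrow> nat \<Rightarrow> nat" where
  "bdist u v = (case coords u of (s, l, i) \<Rightarrow> case coords v of (t, m, j) \<Rightarrow>
     if s \<noteq> t then Suc (l + m)
     else if i = j \<or> l \<le> b \<or> m \<le> b then (l - m) + (m - l)
     else (l - b) + (m - b))"

lemma bdist_vx [simp]:
  "bdist (vx s l i) (vx t m j) =
     (if s \<noteq> t then Suc (l + m)
      else if i = j \<or> l \<le> b \<or> m \<le> b then (l - m) + (m - l)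
      else (l - b) + (m - b))"
  by (simp add: bdist_def)

lemma bdist_self [simp]: "bdist u u = 0"
  by (simp add: bdist_def split: prod.split)

lemma distance_ported:
  assumes "u \<in> pverts broom" "v \<in> pverts broom"
  shows "distance (ported \<phi>) u v = bdist u v"
proof (rule distance_eqI)
  show "parcs (graph (ported \<phi>)) \<subseteq> nodes (ported \<phi>) \<times> nodes (ported \<phi>)"
    using arcs_subset by simp
  show "u \<in> nodes (ported \<phi>)" "v \<in> nodes (ported \<phi>)" using assms by auto
next
  fix x
  assume "x \<in> nodes (ported \<phi>)"
  then show "bdist x v = 0 \<longleftrightarrow> x = v"
    using assms(2) by (auto simp: is_node_def elim!: in_vertsE split: if_splits)
next
  fix x w
  assume "(x, w) \<in> parcs (graph (ported \<phi>))"
  then show "bdist x v \<le> Suc (bdist w v)"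
    using assms(2)
    by (auto simp: is_node_def is_edge_def elim!: in_vertsE in_arcsE split: if_splits)
next
  fix x
  assume x: "x \<in> nodes (ported \<phi>)" "x \<noteq> v"
  obtain s l i where s: "x = vx s l i" "is_node s l i" using x by (auto elim: in_vertsE)
  obtain t m j where t: "v = vx t m j" "is_node t m j" using assms by (auto elim: in_vertsE)
  show "\<exists>w. (x, w) \<in> parcs (graph (ported \<phi>)) \<and> bdist x v = Suc (bdist w v)"
  \<comment> \<open>In this case \<open>v\<close> lies beyond \<open>x\<close> as seen from the
    center, and the next node towards it is a child, at the fork the one on the tine of
    \<open>v\<close>. Otherwise it is the parent.\<close>
  proof (cases "s = t \<and> l < m \<and> (i = j \<or> l \<le> b)")
    case True
    let ?c = "if l = b then j else 0"
    have "?c < children s l"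
      using s t True b_less_h by (auto simp: children_def is_node_def split: if_splits)
    moreover have "bdist x v = Suc (bdist (child s l i ?c) v)"
      using s t True by (auto simp: child_def is_node_def split: if_splits)
    ultimately show ?thesis using child_in_arcs[OF s(2)] s(1) by (intro exI[of _ "child s l i ?c"]) simp
  next
    case False
    have "bdist x v = Suc (bdist (parent s l i) v)"
      using s t False x(2) by (auto simp: parent_def is_node_def split: if_splits)
    then show ?thesis
      using parent_in_arcs[OF s(2)] s(1) by (intro exI[of _ "parent s l i"]) simp
  qed
qed

lemma diameter_ported: "diameter (ported \<phi>) = Suc (2 * h)"
  unfolding diameter_def
proof (rule Max_eqI)
  show "finite ((\<lambda>(u, v). distance (ported \<phi>) u v) ` (nodes (ported \<phi>) \<times> nodes (ported \<phi>)))"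
    using finite_verts by simp
next
  fix y
  assume "y \<in> (\<lambda>(u, v). distance (ported \<phi>) u v) ` (nodes (ported \<phi>) \<times> nodes (ported \<phi>))"
  then obtain u v where uv: "u \<in> pverts broom" "v \<in> pverts broom" "y = bdist u v"
    by (auto simp: distance_ported)
  then show "y \<le> Suc (2 * h)"
    by (auto simp: is_node_def elim!: in_vertsE)
next
  have n: "is_node s h 0" for s using k_pos by (simp add: is_node_def)
  then show "Suc (2 * h) \<in>
    (\<lambda>(u, v). distance (ported \<phi>) u v) ` (nodes (ported \<phi>) \<times> nodes (ported \<phi>))"
    by (intro image_eqI[of _ _ "(vx True h 0, vx False h 0)"]) (auto simp: distance_ported)
qed

end

section \<open>Views, walks and advice\<close>

text \<open>The views compared later come from one graph with different ports, so \<open>f\<close>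
  may be an isomorphism of the whole graphs; only the agreement of ports is restricted to the
  ball.\<close>

lemma view_isoI:
  assumes arcs: "parcs (graph T) \<subseteq> nodes T \<times> nodes T"
    and bij: "bij_betw f (nodes T) (nodes T')"
    and arcs_iff: "\<And>x y. x \<in> nodes T \<Longrightarrow> y \<in> nodes T \<Longrightarrow>
      (f x, f y) \<in> parcs (graph T') \<longleftrightarrow> (x, y) \<in> parcs (graph T)"
    and dist: "\<And>x. x \<in> nodes T \<Longrightarrow> distance T' (f v) (f x) = distance T v x"
    and degree: "\<And>x. x \<in> nodes T \<Longrightarrow> degree T' (f x) = degree T x"
    and port: "\<And>x y. (x, y) \<in> parcs (graph T) \<Longrightarrow> distance T v x \<le> r \<Longrightarrow> distance T v y \<le> r \<Longrightarrow>
      port T' (f x, f y) = port T (x, y)"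
  shows "view_iso (view_at T v r) (view_at T' (f v) r)"
proof -
  let ?B = "{u \<in> nodes T. distance T v u \<le> r}"
  let ?B' = "{u \<in> nodes T'. distance T' (f v) u \<le> r}"
  have img: "f ` nodes T = nodes T'" and inj: "inj_on f (nodes T)"
    using bij by (auto simp: bij_betw_def)
  have "bij_betw f ?B ?B'"
    unfolding bij_betw_def
  proof
    show "inj_on f ?B" using inj by (auto intro: inj_on_subset)
    show "f ` ?B = ?B'"
      using dist img[symmetric] by (auto simp: image_iff)
  qed
  moreover have "f x \<in> nodes T'" if "x \<in> nodes T" for x using img that by auto
  ultimately show ?thesis
    using arcs arcs_iff dist degree port
    unfolding view_iso_def view_at_def Let_def
    by (intro exI[of _ f]) auto
qed

text \<open>\<open>view_iso\<close> constrains ports only on the arcs of \<open>V\<close>. The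
  inverse bijection carries this over because arcs of \<open>W\<close> run between nodes of
  \<open>W\<close>, where arcs correspond in both directions.\<close>

lemma view_iso_sym:
  assumes "view_iso V W"
    and "root V \<in> nodes (view_graph V)"
    and "parcs (graph (view_graph V)) \<subseteq> nodes (view_graph V) \<times> nodes (view_graph V)"
    and "parcs (graph (view_graph W)) \<subseteq> nodes (view_graph W) \<times> nodes (view_graph W)"
  shows "view_iso W V"
proof -
  obtain f where f: "bij_betw f (nodes (view_graph V)) (nodes (view_graph W))"
    "f (root V) = root W"
    "\<And>x y. x \<in> nodes (view_graph V) \<Longrightarrow> y \<in> nodes (view_graph V) \<Longrightarrow>
       (x, y) \<in> parcs (graph (view_graph V)) \<longleftrightarrow> (f x, f y) \<in> parcs (graph (view_graph W))"
    "\<And>x y. (x, y) \<in> parcs (graph (view_graph V)) \<Longrightarrow>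
       port (view_graph W) (f x, f y) = port (view_graph V) (x, y)"
    "\<And>x. x \<in> nodes (view_graph V) \<Longrightarrow> frontier_degree W (f x) = frontier_degree V x"
    using assms(1) unfolding view_iso_def by (elim exE conjE) (rule that; blast)
  let ?g = "inv_into (nodes (view_graph V)) f"
  have g: "bij_betw ?g (nodes (view_graph W)) (nodes (view_graph V))"
    using f(1) by (rule bij_betw_inv_into)
  have fg: "f (?g x) = x" if "x \<in> nodes (view_graph W)" for x
    using f(1) that by (rule bij_betw_inv_into_right)
  have in_V: "?g x \<in> nodes (view_graph V)" if "x \<in> nodes (view_graph W)" for x
    using g that by (rule bij_betw_apply)
  have root: "?g (root W) = root V"
    using f(1) f(2)[symmetric] assms(2) by (simp add: bij_betw_inv_into_left)
  have arcs: "(x, y) \<in> parcs (graph (view_graph W)) \<longleftrightarrow>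
      (?g x, ?g y) \<in> parcs (graph (view_graph V))"
    if "x \<in> nodes (view_graph W)" "y \<in> nodes (view_graph W)" for x y
    using f(3)[OF in_V[OF that(1)] in_V[OF that(2)]] fg that by simp
  have port: "port (view_graph V) (?g x, ?g y) = port (view_graph W) (x, y)"
    if "(x, y) \<in> parcs (graph (view_graph W))" for x y
  proof -
    have "x \<in> nodes (view_graph W)" "y \<in> nodes (view_graph W)" using that assms(4) by auto
    then show ?thesis using f(4)[of "?g x" "?g y"] arcs fg that by simp
  qed
  show ?thesis
    unfolding view_iso_def
    using g root arcs port f(5)[OF in_V] fg by (intro exI[of _ ?g]) auto
qed

lemma view_at_sel [simp]:
  "nodes (view_graph (view_at T v r)) = {u \<in> nodes T. distance T v u \<le> r}"
  "parcs (graph (view_graph (view_at T v r))) =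
     {(x, y) \<in> parcs (graph T). x \<in> nodes T \<and> y \<in> nodes T \<and>
       distance T v x \<le> r \<and> distance T v y \<le> r}"
  "root (view_at T v r) = v"
  "frontier_degree (view_at T v r) u =
     (if u \<in> nodes T \<and> distance T v u = r then Some (degree T u) else None)"
  by (auto simp: view_at_def Let_def)

lemma port_view_at [simp]:
  assumes "(x, y) \<in> parcs (graph (view_graph (view_at T v r)))"
  shows "port (view_graph (view_at T v r)) (x, y) = port T (x, y)"
  using assms by (auto simp: view_at_def Let_def)

lemma port_inject:
  assumes "port_tree T" "parcs (graph T) \<subseteq> nodes T \<times> nodes T"
    and "(x, y) \<in> parcs (graph T)" "(x, z) \<in> parcs (graph T)"
    and "port T (x, y) = port T (x, z)"
  shows "y = z"
proof -
  have "inj_on (port T) (out_arcs (with_proj (graph T)) x)"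
    using assms(1-3) unfolding port_tree_def bij_betw_def by auto
  from inj_onD[OF this assms(5)] show ?thesis using assms(3,4) by (simp add: out_arcs_def)
qed

text \<open>Ports at a node are distinct, so a walk is determined by its start and its ports. As
  \<open>p\<close> stays in the region \<open>A\<close> where \<open>f\<close> preserves ports,
  \<open>q\<close> has to be its image.\<close>

lemma walk_follows_ports:
  assumes "vwalk p (with_proj (graph T))" "vwalk q (with_proj (graph T'))" "hd q = f (hd p)"
    and "map (port T) (vwalk_arcs p) = map (port T') (vwalk_arcs q)" "set p \<subseteq> A"
    and pres: "\<And>x y. x \<in> A \<Longrightarrow> y \<in> A \<Longrightarrow> (x, y) \<in> parcs (graph T) \<Longrightarrow>
      (f x, f y) \<in> parcs (graph T') \<and> port T' (f x, f y) = port T (x, y)"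
    and inj: "\<And>x y z. (x, y) \<in> parcs (graph T') \<Longrightarrow> (x, z) \<in> parcs (graph T') \<Longrightarrow>
      port T' (x, y) = port T' (x, z) \<Longrightarrow> y = z"
  shows "q = map f p"
  using assms(1-5)
proof (induction p arbitrary: q rule: vwalk_arcs.induct)
  case 1
  then show ?case by auto
next
  case (2 x)
  then show ?case by (cases q rule: vwalk_arcs.cases) auto
next
  case (3 x y ps)
  from "3.prems" obtain y' qs where q: "q = f x # y' # qs"
    by (cases q rule: vwalk_arcs.cases) auto
  have arc: "(x, y) \<in> parcs (graph T)" "vwalk (y # ps) (with_proj (graph T))"
    "(f x, y') \<in> parcs (graph T')" "vwalk (y' # qs) (with_proj (graph T'))"
    using "3.prems"(1,2) q by (auto simp: vwalk_def)
  have "y' = f y"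
    using inj[OF arc(3), of "f y"] pres[of x y] arc(1) "3.prems"(4,5) q by simp
  then have "y' # qs = map f (y # ps)"
    using arc "3.prems"(4,5) q by (intro "3.IH") auto
  then show ?case using q by simp
qed

text \<open>The halting rounds must agree: in the earlier of two different rounds one node would
  halt, while the other, on a view answered alike, would not.\<close>

lemma same_output:
  assumes "\<exists>r\<le>\<tau>. halts_at alg a T v r \<and> alg (view_at T v r) a = Some x"
    and "\<exists>r\<le>\<tau>. halts_at alg a T' v' r \<and> alg (view_at T' v' r) a = Some y"
    and "\<And>r. r \<le> \<tau> \<Longrightarrow> alg (view_at T v r) a = alg (view_at T' v' r) a"
  shows "x = y"
proof -
  obtain r where r: "r \<le> \<tau>" "halts_at alg a T v r" "alg (view_at T v r) a = Some x"
    using assms(1) by blast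
  obtain r' where r': "r' \<le> \<tau>" "halts_at alg a T' v' r'" "alg (view_at T' v' r') a = Some y"
    using assms(2) by blast
  have "\<not> r < r'" "\<not> r' < r"
    using r r' assms(3) by (auto simp: halts_at_def)
  then show ?thesis using r r' assms(3)[of r] by simp
qed

text \<open>Any node can be the leader when views put no constraint on the outputs. Where all views
  differ, this already gives solvability with a map.\<close>

lemma ex_valid_election:
  assumes "port_tree T"
  shows "\<exists>out. valid_election T out"
proof -
  have pg: "pair_graph (graph T)" and conn: "Digraph_Component.connected (with_proj (graph T))"
    using assms by (auto simp: port_tree_def undirected_tree_def)
  interpret pair_graph "graph T" by (fact pg)
  have sc: "strongly_connected (with_proj (graph T))"
    using sym_arcs conn by (rule symmetric_connected_imp_strongly_connected)
  then obtain ld where ld: "ld \<in> nodes T" by (auto simp: strongly_connected_def)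
  have "\<exists>p. vpath p (with_proj (graph T)) \<and> hd p = v \<and> last p = ld" if "v \<in> nodes T" for v
  proof -
    have "v \<rightarrow>\<^sup>*\<^bsub>with_proj (graph T)\<^esub> ld"
      using sc that ld by (auto simp: strongly_connected_def)
    then show ?thesis
      by (auto simp: reachable_vpath_conv)
  qed
  then obtain p where "\<And>v. v \<in> nodes T \<Longrightarrow>
      vpath (p v) (with_proj (graph T)) \<and> hd (p v) = v \<and> last (p v) = ld"
    by metis
  then show ?thesis
    using ld unfolding valid_election_def
    by (intro exI[of _ "\<lambda>v. map (port T) (vwalk_arcs (p v))"] bexI[of _ ld]) auto
qed

lemma xi_le: "solvable_with_map T \<tau> \<Longrightarrow> xi T \<le> enat \<tau>"
  unfolding xi_def by (rule INF_lower) simp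

text \<open>There are fewer than \<open>2 * 2 ^ m\<close> strings of length at most
  \<open>m\<close>. The factor 1/2 absorbs the leading 2 for every \<open>n \<ge> 2\<close>, so no
  threshold on \<open>n\<close> arises.\<close>

lemma long_advice:
  assumes "finite \<T>" "2 \<le> n" "n \<le> card (advice ` \<T>)"
  shows "\<exists>T\<in>\<T>. 1 / 2 * log 2 (real n) \<le> real (length (advice T :: bool list))"
proof (rule ccontr)
  assume "\<not> ?thesis"
  then have short: "2 * real (length (advice T)) < log 2 (real n)" if "T \<in> \<T>" for T
    using that by (force simp: not_le)
  define m where "m = Max ((length \<circ> advice) ` \<T>)"
  have ne: "\<T> \<noteq> {}" using assms by auto
  then have "m \<in> (length \<circ> advice) ` \<T>" unfolding m_def using assms(1) by (intro Max_in) auto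
  then have "real (2 * m) < log 2 (real n)" using short by auto
  then have "2 powr real (2 * m) < real n" using assms(2) by (simp add: less_log_iff)
  then have "real (2 ^ (2 * m)) < real n" by (subst (asm) powr_realpow) auto
  then have n: "2 ^ m * 2 ^ m < n" by (simp only: of_nat_less_iff power_add mult_2)
  have "advice ` \<T> \<subseteq> {xs. set xs \<subseteq> UNIV \<and> length xs \<le> m}"
    unfolding m_def using assms(1) by auto
  then have "card (advice ` \<T>) \<le> card {xs :: bool list. set xs \<subseteq> UNIV \<and> length xs \<le> m}"
    by (intro card_mono finite_lists_length_le) auto
  also have "\<dots> = (\<Sum>i\<le>m. 2 ^ i)"
    by (subst card_lists_length_le) auto
  also have "\<dots> < 2 * 2 ^ m"
    by (induction m) auto
  finally have "n < 2 * 2 ^ m" using assms(3) by simp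
  \<comment> \<open>The two bounds on \<open>n\<close> leave only \<open>m = 0\<close>, and then
    \<open>n < 2\<close>.\<close>
  with n have "2 ^ m * 2 ^ m < 2 * (2 ^ m :: nat)" by linarith
  then have "(2 :: nat) ^ m < 2 ^ 1" by simp
  then have "m = 0" using power_strict_increasing_iff[of "2 :: nat" m 1] by simp
  then show False using \<open>n < 2 * 2 ^ m\<close> assms(2) by simp
qed

section \<open>Crossing between the two sides\<close>

context double_broom
begin

definition side :: "bool \<Rightarrow> nat set" where
  "side s = {vx s l i | l i. is_node s l i}"

lemma vx_in_side [simp]: "vx s l i \<in> side t \<longleftrightarrow> s = t \<and> is_node s l i"
  by (auto simp: side_def)

lemma in_side_iff: "u \<in> pverts broom \<Longrightarrow> u \<in> side (\<not> s) \<longleftrightarrow> u \<notin> side s"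
  by (auto elim!: in_vertsE)

lemma leaving_side:
  assumes "(u, v) \<in> parcs broom" "u \<in> side s" "v \<notin> side s"
  shows "u = vx s 0 0"
  using assms by (auto elim!: in_arcsE simp: is_edge_def)

lemma walk_enters_at_center:
  assumes "vwalk p (with_proj broom)" "hd p \<notin> side s" "last p \<in> side s"
  shows "vx s 0 0 \<in> set p"
  using assms
proof (induction rule: vwalk_induct)
  case (Base u)
  then show ?case by simp
next
  case (Cons u v es)
  have "v \<notin> side s \<or> v = vx s 0 0"
  proof (rule ccontr)
    assume "\<not> ?thesis"
    moreover have "(v, u) \<in> parcs broom" using Cons(1) sym_arcs by (simp add: symD)
    ultimately show False using leaving_side[of v u s] Cons.prems by simp
  qed
  then show ?case using Cons by auto
qed

text \<open>Leaving the side and coming back leads twice through its center, which a simple path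
  cannot do.\<close>

lemma path_stays_on_side:
  assumes "vwalk p (with_proj broom)" "distinct p" "hd p \<in> side s" "last p \<in> side s"
  shows "set p \<subseteq> side s"
  using assms
proof (induction p rule: list.induct)
  case Nil
  then show ?case by simp
next
  case (Cons u p)
  show ?case
  proof (cases "p = []")
    case True
    then show ?thesis using Cons.prems by simp
  next
    case False
    then have p: "vwalk p (with_proj broom)" "(u, hd p) \<in> parcs broom"
      using Cons.prems(1) by (auto elim: vwalk_consE)
    have "hd p \<in> side s"
    proof (rule ccontr)
      assume "hd p \<notin> side s"
      then have "u = vx s 0 0" "vx s 0 0 \<in> set p"
        using leaving_side[OF p(2)] walk_enters_at_center[OF p(1)] Cons.prems False by auto
      then show False using Cons.prems(2) by simp
    qed
    then show ?thesis using Cons p False by simp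
  qed
qed

end

section \<open>Diameter at least five\<close>


text \<open>With tines of length 2 the diameter is \<open>2 * b + 5\<close>, so
  \<open>2 * b + 3\<close> below is the allowed time. Three tines give the fork a port number that
  only forks have.\<close>

locale marked_broom =
  fixes b n :: nat
  assumes n_ge: "3 \<le> n"
begin

sublocale double_broom b "Suc (Suc b)" "\<lambda>_. n"
  using n_ge by unfold_locales auto

definition mark :: "(bool \<Rightarrow> nat set) \<Rightarrow> bool \<Rightarrow> nat \<Rightarrow> nat \<Rightarrow> nat \<Rightarrow> nat" where
  "mark \<beta> s l i = (if l = Suc b \<and> i \<in> \<beta> s then transpose 0 1 else id)"

abbreviation marked :: "(bool \<Rightarrow> nat set) \<Rightarrow> nat port_graph" where
  "marked \<beta> \<equiv> ported (mark \<beta>)"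

lemma permuted_mark: "permuted (mark \<beta>)"
proof -
  have "{0..<Suc (Suc 0)} = {0 :: nat, 1}" by auto
  then have "bij_betw (transpose 0 1) {0..<Suc (Suc 0)} {0..<Suc (Suc 0) :: nat}"
    by (auto simp: bij_betw_def)
  then show ?thesis
    by (auto simp: permuted_def mark_def children_def bij_betw_id)
qed

lemma port_tree_marked: "port_tree (marked \<beta>)"
  using permuted_mark by (rule port_tree_ported)

text \<open>The mirror symmetry of the broom for \<open>c = True\<close> and the identity for
  \<open>c = False\<close>, so that one map serves tips on equal and on opposite sides.\<close>

definition turn :: "bool \<Rightarrow> nat \<Rightarrow> nat" where
  "turn c u = (case coords u of (s, l, i) \<Rightarrow> vx (s \<noteq> c) l i)"

lemma turn_vx [simp]: "turn c (vx s l i) = vx (s \<noteq> c) l i"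
  by (simp add: turn_def)

lemma bij_turn: "bij_betw (turn c) (pverts broom) (pverts broom)"
  by (rule bij_betw_byWitness[where f' = "turn c"])
    (auto elim!: in_vertsE simp: is_node_def split: if_splits)

abbreviation "tip s \<equiv> vx s (Suc (Suc b)) 0"

text \<open>From a tip, radius \<open>2 * b + 3\<close> ends at the fork of the other side; the
  nodes carrying marks there are at distance \<open>2 * b + 4\<close>. So the set of the other side
  leaves no trace in the view.\<close>

lemma view_iso_turn:
  assumes "\<beta> s = \<gamma> t" "r \<le> 2 * b + 3"
  shows "view_iso (view_at (marked \<beta>) (tip s) r) (view_at (marked \<gamma>) (tip t) r)"
proof -
  let ?c = "s \<noteq> t"
  have tip: "is_node s (Suc (Suc b)) 0" for s using n_ge by (simp add: is_node_def)
  have "view_iso (view_at (marked \<beta>) (tip s) r) (view_at (marked \<gamma>) (turn ?c (tip s)) r)"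
  proof (rule view_isoI)
    show "parcs (graph (marked \<beta>)) \<subseteq> nodes (marked \<beta>) \<times> nodes (marked \<beta>)"
      using arcs_subset by simp
    show "bij_betw (turn ?c) (nodes (marked \<beta>)) (nodes (marked \<gamma>))"
      using bij_turn by simp
  next
    fix x y
    assume "x \<in> nodes (marked \<beta>)" "y \<in> nodes (marked \<beta>)"
    then show "(turn ?c x, turn ?c y) \<in> parcs (graph (marked \<gamma>)) \<longleftrightarrow>
      (x, y) \<in> parcs (graph (marked \<beta>))"
      by (auto elim!: in_vertsE simp: is_edge_def is_node_def)
  next
    fix x
    assume "x \<in> nodes (marked \<beta>)"
    then obtain s' l i where x: "x = vx s' l i" "is_node s' l i" by (auto elim: in_vertsE)
    then have x': "is_node (s' \<noteq> ?c) l i" by (simp add: is_node_def)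
    show "distance (marked \<gamma>) (turn ?c (tip s)) (turn ?c x) = distance (marked \<beta>) (tip s) x"
      using x x' tip by (simp add: distance_ported) auto
    show "degree (marked \<gamma>) (turn ?c x) = degree (marked \<beta>) x"
      using x x' by (simp add: children_def)
  next
    fix x y
    assume arc: "(x, y) \<in> parcs (graph (marked \<beta>))"
      and near: "distance (marked \<beta>) (tip s) x \<le> r" "distance (marked \<beta>) (tip s) y \<le> r"
    obtain s' l i t' m j where x: "x = vx s' l i" "y = vx t' m j" "is_node s' l i"
      "is_node t' m j"
      using arc by (auto elim: in_arcsE)
    have "bdist (tip s) x \<le> 2 * b + 3"
      using near(1) assms(2) x tip by (simp add: distance_ported)
    then have "s' = s \<or> l \<le> b" using x by (auto split: if_splits)
    then have "mark \<gamma> (s' \<noteq> ?c) l i = mark \<beta> s' l i"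
      using assms(1) by (auto simp: mark_def)
    then show "port (marked \<gamma>) (turn ?c x, turn ?c y) = port (marked \<beta>) (x, y)"
      using x by (auto simp: children_def)
  qed
  then show ?thesis by (cases s; cases t) simp_all
qed

text \<open>Ports on a side depend only on the set of that side, so the mirror map preserves them
  there and the second walk is the image of the first.\<close>

lemma same_side_follows:
  assumes "\<beta> s = \<gamma> t"
    and p: "vwalk p (with_proj broom)" "set p \<subseteq> side s"
    and q: "vwalk q (with_proj broom)"
    and hd: "hd p = tip s" "hd q = tip t"
    and ports: "map (port (marked \<beta>)) (vwalk_arcs p) = map (port (marked \<gamma>)) (vwalk_arcs q)"
  shows "set q \<subseteq> side t"
proof -
  let ?c = "s \<noteq> t"
  \<comment> \<open>The Boolean form of the fact that \<open>turn ?c\<close> maps side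
    \<open>s\<close> to side \<open>t\<close>.\<close>
  have st: "(s = (s = t)) = t" by auto
  have "q = map (turn ?c) p"
  proof (rule walk_follows_ports[where A = "side s" and T = "marked \<beta>" and T' = "marked \<gamma>"])
    fix x y
    assume "x \<in> side s" "y \<in> side s" "(x, y) \<in> parcs (graph (marked \<beta>))"
    then show "(turn ?c x, turn ?c y) \<in> parcs (graph (marked \<gamma>)) \<and>
      port (marked \<gamma>) (turn ?c x, turn ?c y) = port (marked \<beta>) (x, y)"
      using assms(1) st
      by (auto simp: side_def is_edge_def is_node_def mark_def children_def)
  next
    fix x y z
    assume "(x, y) \<in> parcs (graph (marked \<gamma>))" "(x, z) \<in> parcs (graph (marked \<gamma>))"
      "port (marked \<gamma>) (x, y) = port (marked \<gamma>) (x, z)"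
    then show "y = z"
      using port_inject[OF port_tree_marked] arcs_subset by simp
  qed (use p q hd ports in auto)
  moreover have "turn ?c x \<in> side t" if "x \<in> side s" for x
  proof -
    from that obtain l i where "x = vx s l i" "is_node s l i" by (auto simp: side_def)
    then show ?thesis using st by (simp add: is_node_def)
  qed
  ultimately show ?thesis using p(2) by auto
qed

text \<open>With equal sets \<open>turn True\<close> would be a port-preserving automorphism without
  fixed nodes, and no election would be feasible.\<close>

definition markings :: "(bool \<Rightarrow> nat set) set" where
  "markings = {\<beta>. \<beta> True \<noteq> \<beta> False \<and> (\<forall>s. \<beta> s \<subseteq> {..<n})}"

lemma finite_markings: "finite markings"
proof (rule finite_subset)
  show "markings \<subseteq> PiE UNIV (\<lambda>_. Pow {..<n})" by (auto simp: markings_def)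
  show "finite (PiE UNIV (\<lambda>_ :: bool. Pow {..<n}))" by (intro finite_PiE) auto
qed

text \<open>Every node sees the fork and the middle nodes of all tines on its side, hence the set
  written there and, as the two sets differ, which side it is on. Ports then force the isomorphism
  to fix the node itself.\<close>

lemma view_iso_marked_imp_eq:
  assumes \<beta>: "\<beta> \<in> markings" and uv: "u \<in> pverts broom" "v \<in> pverts broom"
    and iso: "view_iso (view_at (marked \<beta>) u (2 * b + 3)) (view_at (marked \<beta>) v (2 * b + 3))"
  shows "u = v"
proof -
  let ?r = "2 * b + 3"
  obtain s l i where u: "u = vx s l i" "is_node s l i" using uv(1) by (rule in_vertsE)
  obtain f where f_root: "f u = v"
    and f_arc: "\<And>x y. (x, y) \<in> parcs broom \<Longrightarrow> bdist u x \<le> ?r \<Longrightarrow> bdist u y \<le> ?r \<Longrightarrow>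
      (f x, f y) \<in> parcs broom \<and> port (marked \<beta>) (f x, f y) = port (marked \<beta>) (x, y)"
  proof -
    let ?V = "view_at (marked \<beta>) u ?r" and ?W = "view_at (marked \<beta>) v ?r"
    obtain f where f: "f (root ?V) = root ?W"
      "\<forall>x\<in>nodes (view_graph ?V). \<forall>y\<in>nodes (view_graph ?V).
        (x, y) \<in> parcs (graph (view_graph ?V)) \<longleftrightarrow> (f x, f y) \<in> parcs (graph (view_graph ?W))"
      "\<forall>(x, y)\<in>parcs (graph (view_graph ?V)).
        port (view_graph ?W) (f x, f y) = port (view_graph ?V) (x, y)"
      using iso unfolding view_iso_def by blast
    show thesis
    proof
      show "f u = v" using f(1) by simp
      fix x y
      assume arc: "(x, y) \<in> parcs broom" and near: "bdist u x \<le> ?r" "bdist u y \<le> ?r"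
      have xy: "x \<in> pverts broom" "y \<in> pverts broom" using arc arcs_subset by auto
      then have V: "(x, y) \<in> parcs (graph (view_graph ?V))"
        using arc near uv(1) by (simp add: distance_ported)
      moreover have "x \<in> nodes (view_graph ?V)" "y \<in> nodes (view_graph ?V)"
        using near xy uv(1) by (simp_all add: distance_ported)
      ultimately have W: "(f x, f y) \<in> parcs (graph (view_graph ?W))" using f(2) by blast
      have "port (view_graph ?W) (f x, f y) = port (view_graph ?V) (x, y)" using f(3) V by blast
      then show "(f x, f y) \<in> parcs broom \<and>
        port (marked \<beta>) (f x, f y) = port (marked \<beta>) (x, y)"
        using W port_view_at[OF V] port_view_at[OF W] by simp
    qed
  qed
  have near: "bdist u (vx s m j) \<le> ?r" if "m \<le> Suc b" for m j
    using that u by (auto simp: is_node_def split: if_splits)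
  have inj: "y = z" if "(x, y) \<in> parcs broom" "(x, z) \<in> parcs broom"
    "port (marked \<beta>) (x, y) = port (marked \<beta>) (x, z)" for x y z
    using port_inject[OF port_tree_marked, of \<beta>] arcs_subset that by simp
  have arc: "(vx s b 0, vx s (Suc b) j) \<in> parcs broom" if "j < n" for j
    using that by (auto simp: is_node_def is_edge_def)
  have rev: "(y, x) \<in> parcs broom" if "(x, y) \<in> parcs broom" for x y
    using that sym_arcs by (rule_tac symD)
  \<comment> \<open>The fork at level \<open>b\<close> is recognised by having a port 2.\<close>
  obtain s' where fork: "f (vx s b 0) = vx s' b 0"
  proof -
    have "(f (vx s b 0), f (vx s (Suc b) 2)) \<in> parcs broom"
      "port (marked \<beta>) (f (vx s b 0), f (vx s (Suc b) 2)) = 2"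
      using f_arc[OF arc[of 2] near near] n_ge by (simp_all add: mark_def)
    then show thesis
      using that n_ge
      by (elim in_arcsE)
        (auto simp: mark_def is_node_def is_edge_def children_def split: if_splits)
  qed
  \<comment> \<open>Ports at a fork are never permuted, so port \<open>j\<close> leads to tine
    \<open>j\<close> on either side.\<close>
  have tine: "f (vx s (Suc b) j) = vx s' (Suc b) j" if "j < n" for j
  proof (rule inj)
    show "(vx s' b 0, f (vx s (Suc b) j)) \<in> parcs broom"
      using f_arc[OF arc[OF that] near near] fork by simp
    show "(vx s' b 0, vx s' (Suc b) j) \<in> parcs broom"
      using that by (auto simp: is_node_def is_edge_def)
    show "port (marked \<beta>) (vx s' b 0, f (vx s (Suc b) j)) =
      port (marked \<beta>) (vx s' b 0, vx s' (Suc b) j)"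
      using f_arc[OF arc[OF that] near near] fork by (simp add: mark_def)
  qed
  \<comment> \<open>The port from the middle node of a tine back to the fork is 0 if the tine is
    marked and 1 otherwise.\<close>
  have "j \<in> \<beta> s' \<longleftrightarrow> j \<in> \<beta> s" if "j < n" for j
    using f_arc[OF rev[OF arc[OF that]] near near] fork tine[OF that]
    by (auto simp: mark_def children_def split: if_splits)
  then have "\<beta> s' = \<beta> s" using \<beta> by (auto simp: markings_def)
  then have [simp]: "s' = s" using \<beta> by (cases s; cases s') (auto simp: markings_def)
  have "f u = u"
  proof (cases "l \<le> b")
    case True
    \<comment> \<open>The induction runs from the fork down to the center, each time using the port
      towards the center.\<close>
    have "f (vx s m 0) = vx s m 0" if "m \<le> b" for m
      using that
    proof (induction rule: inc_induct)
      case base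
      then show ?case using fork by simp
    next
      case (step m)
      have a: "(vx s (Suc m) 0, vx s m 0) \<in> parcs broom"
        using step.hyps by (auto simp: is_node_def is_edge_def)
      show ?case
        using f_arc[OF a near near] step inj[OF _ a] by simp
    qed
    then show ?thesis using True u by (auto simp: is_node_def)
  next
    case False
    then have i: "i < n" "l = Suc b \<or> l = Suc (Suc b)" using u by (auto simp: is_node_def)
    show ?thesis
    proof (cases "l = Suc b")
      case True
      then show ?thesis using tine i u by simp
    next
      case False
      then have l: "l = Suc (Suc b)" using i by simp
      have a: "(vx s (Suc b) i, u) \<in> parcs broom"
        using i l u by (auto simp: is_node_def is_edge_def)
      have "bdist u u \<le> ?r" using u by simp
      then show ?thesis
        using f_arc[OF a near] tine[OF i(1)] inj[OF _ a] by simp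
    qed
  qed
  then show ?thesis using f_root by simp
qed

lemma solvable_marked:
  assumes "\<beta> \<in> markings"
  shows "solvable_with_map (marked \<beta>) (2 * b + 3)"
proof -
  obtain out where "valid_election (marked \<beta>) out"
    using ex_valid_election[OF port_tree_marked] by blast
  then show ?thesis
    using view_iso_marked_imp_eq[OF assms] unfolding solvable_with_map_def by auto
qed

lemma many_advices:
  assumes "elects_in_time advice alg (2 * b + 3) (marked ` markings)"
  shows "n \<le> card (advice ` marked ` markings)"
proof -
  let ?r = "2 * b + 3"
  let ?run = "\<lambda>\<beta> s p. \<exists>r\<le>?r.
    halts_at alg (advice (marked \<beta>)) (marked \<beta>) (tip s) r \<and>
    alg (view_at (marked \<beta>) (tip s) r) (advice (marked \<beta>)) =
      Some (map (port (marked \<beta>)) (vwalk_arcs p))"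
  have resp: "respects_views alg" using assms by (simp add: elects_in_time_def)
  have tip: "tip s \<in> pverts broom" for s using n_ge by (simp add: is_node_def)
  \<comment> \<open>Of an election only the leader and the paths of the two tips are kept; the
    leader then becomes a function \<open>ld\<close> of the marking.\<close>
  have "\<exists>ld\<in>pverts broom. \<forall>s. \<exists>p.
      vpath p (with_proj broom) \<and> hd p = tip s \<and> last p = ld \<and> ?run \<beta> s p"
    if \<beta>: "\<beta> \<in> markings" for \<beta>
  proof -
    obtain out where out: "valid_election (marked \<beta>) out"
      "\<And>v. v \<in> pverts broom \<Longrightarrow> \<exists>r\<le>?r. halts_at alg (advice (marked \<beta>)) (marked \<beta>) v r \<and>
        alg (view_at (marked \<beta>) v r) (advice (marked \<beta>)) = Some (out v)"
      using assms \<beta> unfolding elects_in_time_def by auto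
    from out(1) obtain ld where ld: "ld \<in> pverts broom"
      "\<And>v. v \<in> pverts broom \<Longrightarrow> \<exists>p. vpath p (with_proj broom) \<and> hd p = v \<and>
        map (port (marked \<beta>)) (vwalk_arcs p) = out v \<and> last p = ld"
      unfolding valid_election_def by auto
    show ?thesis
    proof (intro bexI[OF _ ld(1)] allI)
      fix s
      show "\<exists>p. vpath p (with_proj broom) \<and> hd p = tip s \<and> last p = ld \<and> ?run \<beta> s p"
        using ld(2)[OF tip[of s]] out(2)[OF tip[of s]] by metis
    qed
  qed
  then obtain ld where ld: "\<And>\<beta>. \<beta> \<in> markings \<Longrightarrow> ld \<beta> \<in> pverts broom \<and> (\<forall>s. \<exists>p.
      vpath p (with_proj broom) \<and> hd p = tip s \<and> last p = ld \<beta> \<and> ?run \<beta> s p)"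
    by metis
  \<comment> \<open>Equal own set and equal advice give equal outputs at the two tips, so if the
    path of the first stays on its side, so does the path of the second. The sides \<open>s\<close>
    and \<open>t\<close> may differ.\<close>
  have transfer: "ld \<gamma> \<in> side t"
    if \<beta>: "\<beta> \<in> markings" and \<gamma>: "\<gamma> \<in> markings" and same: "\<beta> s = \<gamma> t"
      and adv: "advice (marked \<beta>) = advice (marked \<gamma>)" and own: "ld \<beta> \<in> side s"
    for \<beta> \<gamma> s t
  proof -
    obtain p where p: "vpath p (with_proj broom)" "hd p = tip s" "last p = ld \<beta>" "?run \<beta> s p"
      using ld[OF \<beta>] by blast
    obtain q where q: "vpath q (with_proj broom)" "hd q = tip t" "last q = ld \<gamma>" "?run \<gamma> t q"
      using ld[OF \<gamma>] by blast
    have "map (port (marked \<beta>)) (vwalk_arcs p) = map (port (marked \<gamma>)) (vwalk_arcs q)"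
    proof (rule same_output[OF p(4)])
      show "\<exists>r\<le>?r. halts_at alg (advice (marked \<beta>)) (marked \<gamma>) (tip t) r \<and>
        alg (view_at (marked \<gamma>) (tip t) r) (advice (marked \<beta>)) =
          Some (map (port (marked \<gamma>)) (vwalk_arcs q))"
        using q(4) unfolding adv .
      show "alg (view_at (marked \<beta>) (tip s) r) (advice (marked \<beta>)) =
        alg (view_at (marked \<gamma>) (tip t) r) (advice (marked \<beta>))" if "r \<le> ?r" for r
        using resp view_iso_turn[where \<beta> = \<beta> and \<gamma> = \<gamma>, OF same that] port_tree_marked tip
        unfolding respects_views_def by (metis graph_ported)
    qed
    moreover have "set p \<subseteq> side s"
      using p own tip[of s] by (intro path_stays_on_side) (auto simp: vpath_def)
    ultimately have "set q \<subseteq> side t"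
      using p q by (intro same_side_follows[where \<beta> = \<beta> and \<gamma> = \<gamma>, OF same]) (auto simp: vpath_def)
    moreover have "q \<noteq> []" using q(1) by auto
    ultimately show ?thesis using q(3) by (metis last_in_set subsetD)
  qed
  \<comment> \<open>The advice under which a tip with own set \<open>S\<close> has the leader on its
    own side; by \<open>transfer\<close> the choice of the witnessing marking and side does not
    matter.\<close>
  define stays where "stays S =
    {advice (marked \<beta>) | \<beta> s. \<beta> \<in> markings \<and> \<beta> s = S \<and> ld \<beta> \<in> side s}" for S
  have "inj_on stays (Pow {..<n})"
  proof (rule inj_onI, rule ccontr)
    fix S S'
    assume S: "S \<in> Pow {..<n}" "S' \<in> Pow {..<n}" "stays S = stays S'" "S \<noteq> S'"
    \<comment> \<open>This marking separates the two sets: its leader lies on exactly one side, so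
      its advice belongs to exactly one of \<open>stays S\<close> and
      \<open>stays S'\<close>.\<close>
    define \<beta> where "\<beta> s = (if s then S else S')" for s
    have \<beta>: "\<beta> \<in> markings" using S by (auto simp: markings_def \<beta>_def)
    have stays_iff: "advice (marked \<beta>) \<in> stays (\<beta> s) \<longleftrightarrow> ld \<beta> \<in> side s" for s
      unfolding stays_def using \<beta> transfer[OF _ \<beta>] by (auto; metis)
    have "ld \<beta> \<in> side False \<longleftrightarrow> ld \<beta> \<notin> side True"
      using in_side_iff[of "ld \<beta>" True] ld[OF \<beta>] by simp
    then show False
      using stays_iff[of True] stays_iff[of False] S(3) by (simp add: \<beta>_def)
  qed
  moreover have "stays ` Pow {..<n} \<subseteq> Pow (advice ` marked ` markings)"
    by (auto simp: stays_def)
  ultimately have "card (Pow {..<n}) \<le> card (Pow (advice ` marked ` markings))"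
    using finite_markings by (intro card_inj_on_le) auto
  then show ?thesis using finite_markings by (simp add: card_Pow)
qed

end

section \<open>Diameter three\<close>

text \<open>In a view of radius 1 all neighbours of the root lie on the frontier, so their degrees
  are part of the view.\<close>

lemma (in double_broom) view_iso_neighbour:
  assumes "view_iso (view_at (ported \<phi>) u 1) (view_at (ported \<phi>) v 1)"
    and "(u, y) \<in> parcs broom" "v \<in> pverts broom"
  obtains z where "(v, z) \<in> parcs broom"
    "out_degree (with_proj broom) z = out_degree (with_proj broom) y"
proof -
  let ?V = "view_at (ported \<phi>) u 1" and ?W = "view_at (ported \<phi>) v 1"
  obtain f where f: "bij_betw f (nodes (view_graph ?V)) (nodes (view_graph ?W))"
    "f (root ?V) = root ?W"
    "\<forall>x\<in>nodes (view_graph ?V). \<forall>y\<in>nodes (view_graph ?V).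
      (x, y) \<in> parcs (graph (view_graph ?V)) \<longleftrightarrow> (f x, f y) \<in> parcs (graph (view_graph ?W))"
    "\<forall>x\<in>nodes (view_graph ?V). frontier_degree ?W (f x) = frontier_degree ?V x"
    using assms(1) unfolding view_iso_def by blast
  have uy: "u \<in> pverts broom" "y \<in> pverts broom" using assms(2) arcs_subset by auto
  have d: "distance (ported \<phi>) u u = 0" "distance (ported \<phi>) u y = 1"
    using assms(2) uy
    by (auto simp: distance_ported is_edge_def is_node_def elim!: in_arcsE split: if_splits)
  have V: "u \<in> nodes (view_graph ?V)" "y \<in> nodes (view_graph ?V)"
    "(u, y) \<in> parcs (graph (view_graph ?V))"
    using uy d assms(2) by simp_all
  then have "(v, f y) \<in> parcs broom" using f(2,3) by fastforce
  moreover have "frontier_degree ?W (f y) = Some (out_degree (with_proj broom) y)"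
    using f(4) V(2) uy d(2) by auto
  then have "out_degree (with_proj broom) (f y) = out_degree (with_proj broom) y"
    by (auto split: if_splits)
  ultimately show thesis by (rule that)
qed

text \<open>The bound on \<open>n\<close> leaves each center at least three leaves, so that for any
  two values \<open>p\<close> and \<open>q\<close> some leaf index differs from both.\<close>

locale double_star =
  fixes n :: nat
  assumes n_ge: "4 \<le> n"
begin

text \<open>Unequal numbers of leaves break the symmetry between the sides, whose centers have the
  same port at the central edge.\<close>

definition arity :: "bool \<Rightarrow> nat" where
  "arity s = (if s then n - 1 else n)"

lemma arity_ge: "3 \<le> arity s" "p < n \<Longrightarrow> p \<le> arity s"
  using n_ge by (auto simp: arity_def)

lemma arity_inject: "arity s = arity t \<Longrightarrow> s = t"
  using n_ge by (auto simp: arity_def split: if_splits)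

sublocale double_broom 0 "Suc 0" arity
proof
  show "0 < arity s" for s using arity_ge(1)[of s] by simp
qed simp

text \<open>The unpermuted port of the central edge is \<open>arity s\<close>. It is exchanged with
  \<open>p\<close>, so leaves with an index other than \<open>p\<close> keep their port at the
  center.\<close>

definition hide :: "nat \<Rightarrow> bool \<Rightarrow> nat \<Rightarrow> nat \<Rightarrow> nat \<Rightarrow> nat" where
  "hide p s l i = (if l = 0 then transpose p (arity s) else id)"

abbreviation hidden :: "nat \<Rightarrow> nat port_graph" where
  "hidden p \<equiv> ported (hide p)"

abbreviation center :: "bool \<Rightarrow> nat" where
  "center s \<equiv> vx s 0 0"

abbreviation leaf :: "bool \<Rightarrow> nat \<Rightarrow> nat" where
  "leaf s i \<equiv> vx s (Suc 0) i"

lemma is_node_leaf [simp]: "is_node s (Suc 0) i \<longleftrightarrow> i < arity s"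
  by (simp add: is_node_def)

lemma node_cases:
  assumes "u \<in> pverts broom"
  obtains s where "u = center s" | s i where "u = leaf s i" "i < arity s"
proof -
  obtain s l i where u: "u = vx s l i" "is_node s l i" using assms by (rule in_vertsE)
  then have "l = 0 \<or> l = 1" by (auto simp: is_node_def)
  then show thesis using that u by auto
qed

lemma permuted_hide:
  assumes "p < n"
  shows "permuted (hide p)"
  unfolding permuted_def
proof (intro allI impI)
  fix s l i
  show "bij_betw (hide p s l i) {0..<Suc (children s l)} {0..<Suc (children s l)}"
  proof (cases "l = 0")
    case True
    have "p \<le> arity s" using assms by (rule arity_ge)
    then have "transpose p (arity s) ` {0..<Suc (arity s)} = {0..<Suc (arity s)}"
      by (intro transpose_image_eq) auto
    then show ?thesis using True by (simp add: hide_def children_def bij_betw_def)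
  next
    case False
    then show ?thesis by (simp add: hide_def bij_betw_id)
  qed
qed

lemma port_tree_hidden: "p < n \<Longrightarrow> port_tree (hidden p)"
  using permuted_hide by (rule port_tree_ported)

text \<open>Within radius 1 a leaf sees only its own edge and the degree of its center. The port of
  that edge at the center is \<open>i\<close> in both trees, as \<open>i\<close> is moved by neither
  transposition.\<close>

lemma view_iso_leaf:
  assumes "i < arity s" "i \<noteq> p" "i \<noteq> q" "r \<le> 1"
  shows "view_iso (view_at (hidden p) (leaf s i) r) (view_at (hidden q) (leaf s i) r)"
proof -
  have "view_iso (view_at (hidden p) (leaf s i) r) (view_at (hidden q) (id (leaf s i)) r)"
  proof (rule view_isoI)
    show "parcs (graph (hidden p)) \<subseteq> nodes (hidden p) \<times> nodes (hidden p)"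
      using arcs_subset by simp
    show "bij_betw id (nodes (hidden p)) (nodes (hidden q))" by (simp add: bij_betw_id del: id_apply)
  next
    fix x
    assume "x \<in> nodes (hidden p)"
    then show "distance (hidden q) (id (leaf s i)) (id x) = distance (hidden p) (leaf s i) x"
      using assms(1) by (simp add: distance_ported)
  next
    fix x y
    assume arc: "(x, y) \<in> parcs (graph (hidden p))"
      and near: "distance (hidden p) (leaf s i) x \<le> r" "distance (hidden p) (leaf s i) y \<le> r"
    have xy: "x \<in> pverts broom" "y \<in> pverts broom" using arc arcs_subset by auto
    then have "bdist (leaf s i) x \<le> 1" "bdist (leaf s i) y \<le> 1"
      using near assms by (auto simp: distance_ported)
    then have "x = leaf s i \<and> y = center s \<or> x = center s \<and> y = leaf s i"
      using xy arc by (elim node_cases) (auto simp: is_edge_def split: if_splits)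
    then show "port (hidden q) (id x, id y) = port (hidden p) (x, y)"
      using assms by (auto simp: hide_def)
  qed auto
  then show ?thesis by simp
qed

section \<open>Paths from a leaf\<close>

lemma leaf_neighbour: "(leaf s i, y) \<in> parcs broom \<longleftrightarrow> i < arity s \<and> y = center s"
  by (auto elim!: in_arcsE simp: is_edge_def is_node_def)

lemma walk_from_leaf:
  assumes "vwalk P (with_proj broom)" "hd P = leaf s i"
  obtains "P = [leaf s i]"
  | R where "P = leaf s i # center s # R" "vwalk (center s # R) (with_proj broom)"
proof (cases P rule: vwalk_arcs.cases)
  case 1
  then show ?thesis using assms(1) by auto
next
  case (2 x)
  then show ?thesis using that(1) assms(2) by simp
next
  case (3 x y zs)
  then have "(leaf s i, y) \<in> parcs broom" "vwalk (y # zs) (with_proj broom)"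
    using assms by (auto simp: vwalk_def)
  then show ?thesis using 3 that(2) assms(2) leaf_neighbour by auto
qed

text \<open>Any neighbour of \<open>center s\<close> other than the opposite center is a leaf, where
  a simple path has to end, still on side \<open>s\<close>.\<close>

lemma path_from_leaf:
  assumes "vpath P (with_proj broom)" "hd P = leaf s i" "last P \<notin> side s" "i < arity s"
  obtains R where "P = leaf s i # center s # center (\<not> s) # R"
proof -
  have P: "vwalk P (with_proj broom)" "distinct P" using assms(1) by auto
  from P(1) assms(2) show thesis
  proof (cases rule: walk_from_leaf)
    case 1
    then show ?thesis using assms(3,4) by simp
  next
    case (2 R)
    have "R \<noteq> []" using 2 assms(3) by auto
    then obtain y R' where R: "R = y # R'" by (cases R) auto
    have y: "(center s, y) \<in> parcs broom" "vwalk (y # R') (with_proj broom)"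
      using 2(2) R by (auto simp: vwalk_def)
    have "y = center (\<not> s)"
    proof (rule ccontr)
      assume "y \<noteq> center (\<not> s)"
      then obtain j where j: "y = leaf s j" "j < arity s"
        using y(1) by (auto elim!: in_arcsE simp: is_edge_def)
      have "hd (y # R') = leaf s j" using j by simp
      with y(2) have "R' = []"
      proof (cases rule: walk_from_leaf)
        case (2 R'')
        then show ?thesis using P(2) \<open>P = leaf s i # center s # R\<close> R by auto
      qed simp
      then show False using 2 R j assms(3) by simp
    qed
    then show ?thesis using that 2 R by simp
  qed
qed

text \<open>The leaders of the two trees may lie on different sides, so one leaf does not suffice;
  comparing the outputs of leaf \<open>i\<close> on both sides gives the contradiction.\<close>

lemma inj_advice:
  assumes "elects_in_time advice alg 1 (hidden ` {..<n})"
  shows "inj_on (advice \<circ> hidden) {..<n}"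
proof (rule inj_onI, rule ccontr)
  fix p q
  assume pq: "p \<in> {..<n}" "q \<in> {..<n}" "(advice \<circ> hidden) p = (advice \<circ> hidden) q" "p \<noteq> q"
  then have adv: "advice (hidden p) = advice (hidden q)" by simp
  define a where "a = advice (hidden p)"
  have resp: "respects_views alg" using assms by (simp add: elects_in_time_def)
  \<comment> \<open>Three candidates against two exclusions; indices below 3 occur on both
    sides.\<close>
  have "\<exists>i::nat. i < 3 \<and> i \<noteq> p \<and> i \<noteq> q" by presburger
  then obtain i where i: "i < 3" "i \<noteq> p" "i \<noteq> q" by blast
  have i_less: "i < arity s" for s using i arity_ge(1)[of s] by simp
  have "\<exists>ld out. ld \<in> pverts broom \<and> (\<forall>s. (\<exists>P. vpath P (with_proj broom) \<and>
      hd P = leaf s i \<and> map (port (hidden x)) (vwalk_arcs P) = out (leaf s i) \<and> last P = ld) \<and>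
      (\<exists>r\<le>1. halts_at alg a (hidden x) (leaf s i) r \<and>
        alg (view_at (hidden x) (leaf s i) r) a = Some (out (leaf s i))))"
    if "x \<in> {p, q}" for x
  proof -
    have x: "hidden x \<in> hidden ` {..<n}" "advice (hidden x) = a" using that pq adv
      by (auto simp: a_def)
    then obtain out where out: "valid_election (hidden x) out"
      "\<And>v. v \<in> pverts broom \<Longrightarrow> \<exists>r\<le>1. halts_at alg a (hidden x) v r \<and>
        alg (view_at (hidden x) v r) a = Some (out v)"
      using assms unfolding elects_in_time_def by fastforce
    from out(1) obtain ld where "ld \<in> pverts broom"
      "\<And>v. v \<in> pverts broom \<Longrightarrow> \<exists>P. vpath P (with_proj broom) \<and> hd P = v \<and>
        map (port (hidden x)) (vwalk_arcs P) = out v \<and> last P = ld"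
      unfolding valid_election_def by auto
    then show ?thesis
      using out(2) i_less by (intro exI[of _ ld] exI[of _ out]) simp
  qed
  from this[of p] this[of q] obtain ld out ld' out' where
    ld: "ld \<in> pverts broom" and ld': "ld' \<in> pverts broom" and
    P: "\<And>s. \<exists>P. vpath P (with_proj broom) \<and> hd P = leaf s i \<and>
      map (port (hidden p)) (vwalk_arcs P) = out (leaf s i) \<and> last P = ld" and
    run: "\<And>s. \<exists>r\<le>1. halts_at alg a (hidden p) (leaf s i) r \<and>
      alg (view_at (hidden p) (leaf s i) r) a = Some (out (leaf s i))" and
    Q: "\<And>s. \<exists>Q. vpath Q (with_proj broom) \<and> hd Q = leaf s i \<and>
      map (port (hidden q)) (vwalk_arcs Q) = out' (leaf s i) \<and> last Q = ld'" and
    run': "\<And>s. \<exists>r\<le>1. halts_at alg a (hidden q) (leaf s i) r \<and>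
      alg (view_at (hidden q) (leaf s i) r) a = Some (out' (leaf s i))"
    by simp blast
  have out_eq: "out (leaf s i) = out' (leaf s i)" for s
  proof (rule same_output[OF run run'])
    fix r :: nat
    assume "r \<le> 1"
    then show "alg (view_at (hidden p) (leaf s i) r) a = alg (view_at (hidden q) (leaf s i) r) a"
      using resp view_iso_leaf[OF i_less i(2,3), of r s] port_tree_hidden pq(1,2) i_less
      unfolding respects_views_def
      by (metis One_nat_def graph_ported is_node_leaf lessThan_iff vx_in_verts)
  qed
  \<comment> \<open>\<open>s\<close> is the side without the leader of \<open>hidden p\<close>.
    Index 1 marks the paths from the leaf on side \<open>s\<close>, index 2 those from the leaf on
    the other side; each \<open>Q\<close> path in \<open>hidden q\<close> has the same ports as its
    \<open>P\<close> path in \<open>hidden p\<close>.\<close>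
  obtain s where s: "ld \<notin> side s" using in_side_iff[OF ld] by blast
  obtain P\<^sub>1 where P1: "vpath P\<^sub>1 (with_proj broom)" "hd P\<^sub>1 = leaf s i" "last P\<^sub>1 = ld"
    "map (port (hidden p)) (vwalk_arcs P\<^sub>1) = out (leaf s i)" using P by blast
  obtain Q\<^sub>1 where Q1: "vpath Q\<^sub>1 (with_proj broom)" "hd Q\<^sub>1 = leaf s i" "last Q\<^sub>1 = ld'"
    "map (port (hidden q)) (vwalk_arcs Q\<^sub>1) = out (leaf s i)" using Q out_eq by metis
  obtain P\<^sub>2 where P2: "vpath P\<^sub>2 (with_proj broom)" "hd P\<^sub>2 = leaf (\<not> s) i" "last P\<^sub>2 = ld"
    "map (port (hidden p)) (vwalk_arcs P\<^sub>2) = out (leaf (\<not> s) i)" using P by blast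
  obtain Q\<^sub>2 where Q2: "vpath Q\<^sub>2 (with_proj broom)" "hd Q\<^sub>2 = leaf (\<not> s) i" "last Q\<^sub>2 = ld'"
    "map (port (hidden q)) (vwalk_arcs Q\<^sub>2) = out (leaf (\<not> s) i)" using Q out_eq by metis
  have len: "length Q\<^sub>1 = length P\<^sub>1" "length Q\<^sub>2 = length P\<^sub>2"
  proof -
    have "length (vwalk_arcs R) = length R - 1" for R :: "nat list"
      by (rule vwalk_length_simp[unfolded vwalk_length_def])
    then show "length Q\<^sub>1 = length P\<^sub>1" "length Q\<^sub>2 = length P\<^sub>2"
      using P1 Q1 P2 Q2
      by (metis One_nat_def Suc_pred length_greater_0_conv length_map vpathE vwalkE)+
  qed
  obtain R where R: "P\<^sub>1 = leaf s i # center s # center (\<not> s) # R"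
    using path_from_leaf[OF P1(1,2)] P1(3) s i_less by blast
  have hop: "port (hidden p) (center s, center (\<not> s)) = p"
    "port (hidden q) (center s, center (\<not> s)) = q"
    by (simp_all add: hide_def children_def)
  obtain y R' where Q1_eq: "Q\<^sub>1 = leaf s i # center s # y # R'"
    using Q1(1,2)
  proof (elim vpathE)
    assume "vwalk Q\<^sub>1 (with_proj broom)"
    then show thesis
      using Q1(2)
    proof (cases rule: walk_from_leaf)
      case 1
      then show ?thesis using len(1) R by simp
    next
      case (2 S)
      then show ?thesis using that len(1) R by (cases S) auto
    qed
  qed
  have "map (port (hidden p)) (vwalk_arcs P\<^sub>1) = map (port (hidden q)) (vwalk_arcs Q\<^sub>1)"
    using P1(4) Q1(4) by simp
  then have "port (hidden q) (center s, y) = p"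
    using hop by (simp add: R Q1_eq)
  \<comment> \<open>In \<open>hidden q\<close> the port \<open>p\<close> at the center does not lead
    across, so \<open>Q\<^sub>1\<close> turns into a leaf of side \<open>s\<close> and has to stop
    there.\<close>
  then have "y \<noteq> center (\<not> s)" using hop pq(4) by auto
  then have "ld' \<in> side s"
    using path_from_leaf[OF Q1(1,2)] Q1(3) Q1_eq i_less by (metis list.inject)
  have "R' = []"
  proof -
    have w: "(center s, y) \<in> parcs broom" "vwalk (y # R') (with_proj broom)" "distinct Q\<^sub>1"
      using Q1(1) Q1_eq by (auto simp: vpath_def vwalk_def)
    then obtain j where j: "y = leaf s j"
      using \<open>y \<noteq> center (\<not> s)\<close> by (auto elim!: in_arcsE simp: is_edge_def)
    then have "hd (y # R') = leaf s j" by simp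
    with w(2) show ?thesis
    proof (cases rule: walk_from_leaf)
      case (2 S)
      then show ?thesis using w(3) Q1_eq by auto
    qed simp
  qed
  \<comment> \<open>Equal outputs give equal lengths, so \<open>P\<^sub>1\<close> stops right after
    crossing the central edge.\<close>
  then have "R = []" using len(1) R Q1_eq by simp
  then have ld_eq: "ld = center (\<not> s)" using P1(3) R by simp
  \<comment> \<open>On the other side the leader of \<open>hidden p\<close> is one step from the
    leaf. The same output places the leader of \<open>hidden q\<close> at that center, hence not on
    side \<open>s\<close>.\<close>
  have "length P\<^sub>2 = 2"
  proof -
    have "vwalk P\<^sub>2 (with_proj broom)" "distinct P\<^sub>2" using P2(1) by auto
    from this(1) P2(2) show ?thesis
    proof (cases rule: walk_from_leaf)
      case 1
      then show ?thesis using P2(3) ld_eq by simp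
    next
      case (2 S)
      then show ?thesis using \<open>distinct P\<^sub>2\<close> P2(3) ld_eq by (cases S rule: rev_cases) auto
    qed
  qed
  then have len2: "length Q\<^sub>2 = 2" using len(2) by simp
  have "vwalk Q\<^sub>2 (with_proj broom)" using Q2(1) by auto
  from this Q2(2) have "ld' = center (\<not> s)"
    by (cases rule: walk_from_leaf) (use Q2(3) len2 in auto)
  then show False using \<open>ld' \<in> side s\<close> by simp
qed

text \<open>The degrees of the neighbours decide: a center has a neighbour of degree 1 and a leaf
  has none, and only \<open>center s\<close> has degree \<open>Suc (arity s)\<close>, which tells
  the sides apart.\<close>

lemma view_iso_imp_same_kind:
  assumes "view_iso (view_at (hidden p) u 1) (view_at (hidden p) v 1)"
    and "u \<in> pverts broom" "v \<in> pverts broom"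
  shows "(\<exists>s. u = center s \<and> v = center s) \<or> (\<exists>s i j. u = leaf s i \<and> v = leaf s j)"
proof -
  have "view_iso (view_at (hidden p) v 1) (view_at (hidden p) u 1)"
    using assms by (intro view_iso_sym[OF assms(1)]) (auto simp: distance_ported)
  note nb = view_iso_neighbour[OF assms(1)] view_iso_neighbour[OF this]
  have deg: "out_degree (with_proj broom) (center s) = Suc (arity s)"
    "i < arity s \<Longrightarrow> out_degree (with_proj broom) (leaf s i) = 1" for s i
    by (simp_all add: children_def)
  have big: "z = center s"
    if z: "z \<in> pverts broom" "out_degree (with_proj broom) z = Suc (arity s)" for z s
    using z(1)
  proof (cases rule: node_cases)
    case (1 t)
    then show ?thesis using z(2) deg(1) arity_inject by simp
  next
    case (2 t i)
    then show ?thesis using z(2) deg(2) arity_ge(1)[of s] by simp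
  qed
  have not_both: False
    if iso: "view_iso (view_at (hidden p) (center s) 1) (view_at (hidden p) (leaf t i) 1)"
      and i: "i < arity t" for s t i
  proof -
    have arc: "(center s, leaf s 0) \<in> parcs broom"
      using arity_ge(1)[of s] by (auto simp: is_edge_def)
    obtain z where "(leaf t i, z) \<in> parcs broom"
      "out_degree (with_proj broom) z = out_degree (with_proj broom) (leaf s 0)"
      using view_iso_neighbour[OF iso arc] i by auto
    then show False
      using deg(1)[of t] deg(2)[of 0 s] arity_ge(1)[of s] arity_ge(1)[of t] leaf_neighbour by auto
  qed
  show ?thesis
    using assms(2)
  proof (cases rule: node_cases)
    case (1 s)
    have arc: "(center s, center (\<not> s)) \<in> parcs broom" by (simp add: is_edge_def)
    obtain z where z: "(v, z) \<in> parcs broom"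
      "out_degree (with_proj broom) z = out_degree (with_proj broom) (center (\<not> s))"
      using nb(1) assms(3) arc 1 by metis
    then have "z = center (\<not> s)" using big deg(1) arcs_subset by auto
    from assms(3) show ?thesis
    proof (cases rule: node_cases)
      case (1 t)
      then show ?thesis using z(1) \<open>z = center (\<not> s)\<close> \<open>u = center s\<close> by (auto simp: is_edge_def)
    next
      case (2 t i)
      then show ?thesis using not_both[of s t i] assms(1) \<open>u = center s\<close> by simp
    qed
  next
    case (2 s i)
    then have arc: "(leaf s i, center s) \<in> parcs broom" by (simp add: is_edge_def)
    obtain z where z: "(v, z) \<in> parcs broom"
      "out_degree (with_proj broom) z = out_degree (with_proj broom) (center s)"
      using nb(1) assms(3) arc 2 by metis
    then have "z = center s" using big deg(1) arcs_subset by auto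
    from assms(3) show ?thesis
    proof (cases rule: node_cases)
      case (1 t)
      then show ?thesis
        using not_both[of t s i] \<open>view_iso (view_at (hidden p) v 1) (view_at (hidden p) u 1)\<close> 2
        by simp
    next
      case (2 t i)
      then show ?thesis using z(1) \<open>z = center s\<close> \<open>u = leaf s _\<close> by (auto simp: is_edge_def)
    qed
  qed
qed

lemma solvable_hidden: "solvable_with_map (hidden p) 1"
proof -
  \<comment> \<open>The leader is \<open>center True\<close>. All leaves of one side share an
    output, so a node only has to recognise its kind and its side; \<open>p\<close> is known from
    the map.\<close>
  let ?out = "\<lambda>u. case coords u of (s, l, i) \<Rightarrow>
    (if l = 0 then [] else [0]) @ (if s then [] else [p])"
  have "valid_election (hidden p) ?out"
    unfolding valid_election_def
  proof (intro bexI[of _ "center True"] ballI)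
    fix v
    assume "v \<in> nodes (hidden p)"
    then have v: "v \<in> pverts broom" by simp
    then show "\<exists>P. vpath P (with_proj (graph (hidden p))) \<and> hd P = v \<and>
      map (port (hidden p)) (vwalk_arcs P) = ?out v \<and> last P = center True"
    proof (cases rule: node_cases)
      case (1 s)
      then show ?thesis
        by (intro exI[of _ "if s then [center True] else [center False, center True]"])
          (auto simp: vpath_def vwalk_def is_edge_def hide_def children_def)
    next
      case (2 s i)
      then show ?thesis
        by (intro exI[of _ "if s then [leaf s i, center True]
            else [leaf s i, center False, center True]"])
          (auto simp: vpath_def vwalk_def is_edge_def hide_def children_def)
    qed
  qed simp
  moreover have "?out u = ?out v"
    if "u \<in> pverts broom" "v \<in> pverts broom"
      "view_iso (view_at (hidden p) u 1) (view_at (hidden p) v 1)" for u v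
    using view_iso_imp_same_kind[OF that(3,1,2)] by auto
  ultimately show ?thesis
    unfolding solvable_with_map_def by (intro exI[of _ ?out]) auto
qed

end

section \<open>Choosing the class for given \<open>n\<close> and \<open>D\<close>\<close>

theorem theorem4p3:
  "\<exists>(c\<^sub>1::real) (c\<^sub>2::real) (c::real) (N::nat). c\<^sub>1 > 0 \<and> c\<^sub>2 > 0 \<and> c > 0 \<and>
     (\<forall>(n::nat) (D::nat). 3 \<le> D \<and> D < n \<and> odd D \<longrightarrow>
        (\<exists>\<T> :: nat port_graph set.
           \<T> \<noteq> {} \<and>
           (\<forall>T\<in>\<T>. port_tree T \<and>
              c\<^sub>1 * real n \<le> real (card (nodes T)) \<and> real (card (nodes T)) \<le> c\<^sub>2 * real n \<and>
              diameter T = D \<and> xi T \<le> enat (D - 2)) \<and>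
           (n \<ge> N \<longrightarrow>
              (\<forall>advice alg. elects_in_time advice alg (D - 2) \<T> \<longrightarrow>
                 (\<exists>T\<in>\<T>. real (length (advice T)) \<ge> c * log 2 (real n))))))"
proof -
  \<comment> \<open>Both constructions give at least \<open>n\<close> different pieces of advice,
    which \<open>long_advice\<close> turns into length for a finite class.\<close>
  have classes: "\<exists>\<T> :: nat port_graph set. finite \<T> \<and> \<T> \<noteq> {} \<and>
      (\<forall>T\<in>\<T>. port_tree T \<and> n \<le> card (nodes T) \<and> card (nodes T) \<le> 5 * n \<and>
        diameter T = D \<and> solvable_with_map T (D - 2)) \<and>
      (\<forall>advice alg. elects_in_time advice alg (D - 2) \<T> \<longrightarrow> n \<le> card (advice ` \<T>))"
    if D: "3 \<le> D" "D < n" "odd D" for n D :: nat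
  proof (cases "D = 3")
    case True
    then interpret double_star n using D by unfold_locales simp
    have "card (nodes (hidden p)) = 2 * n + 1" for p
      using D True by (simp add: card_verts arity_def)
    moreover have "n \<le> card (advice ` hidden ` {..<n})"
      if "elects_in_time advice alg (D - 2) (hidden ` {..<n})" for advice alg
      using card_image[OF inj_advice[of advice alg]] that True by (simp add: image_comp)
    ultimately show ?thesis
      using D True port_tree_hidden solvable_hidden
      by (intro exI[of _ "hidden ` {..<n}"]) (auto simp: diameter_ported)
  next
    case False
    \<comment> \<open>The handle length for which the diameter \<open>2 * b + 5\<close> equals
      \<open>D\<close>.\<close>
    define b where "b = (D - 5) div 2"
    have D_eq: "D = 2 * b + 5" "D - 2 = 2 * b + 3"
      using D False unfolding b_def by presburger+
    interpret marked_broom b n using D by unfold_locales simp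
    have "card (nodes (marked \<beta>)) = 2 * b + 2 + 4 * n" for \<beta>
      by (simp add: card_verts)
    \<comment> \<open>A witness that the class is not empty.\<close>
    moreover have "(\<lambda>s. if s then {} else {..<n}) \<in> markings"
      using D by (auto simp: markings_def)
    ultimately show ?thesis
      unfolding D_eq(2) using D(2) finite_markings port_tree_marked solvable_marked many_advices
      by (intro exI[of _ "marked ` markings"]) (auto simp: diameter_ported D_eq(1))
  qed
  show ?thesis
  \<comment> \<open>The sizes are \<open>2 * n + 1\<close> and \<open>2 * b + 2 + 4 * n\<close> with
    \<open>2 * b + 5 < n\<close>, so they lie between \<open>n\<close> and \<open>5 * n\<close>. The
    factor 1/2 and the threshold 0 come from \<open>long_advice\<close>.\<close>
  proof (rule exI[of _ 1], rule exI[of _ 5], rule exI[of _ "1 / 2"], rule exI[of _ 0],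
      intro conjI allI impI)
    fix n D :: nat
    assume D: "3 \<le> D \<and> D < n \<and> odd D"
    then obtain \<T> :: "nat port_graph set" where T: "finite \<T>" "\<T> \<noteq> {}"
      "\<And>T. T \<in> \<T> \<Longrightarrow> port_tree T \<and> n \<le> card (nodes T) \<and> card (nodes T) \<le> 5 * n \<and>
        diameter T = D \<and> solvable_with_map T (D - 2)"
      "\<And>advice alg. elects_in_time advice alg (D - 2) \<T> \<Longrightarrow> n \<le> card (advice ` \<T>)"
      using classes[of D n] by blast
    have "1 * real n \<le> real (card (nodes T)) \<and> real (card (nodes T)) \<le> 5 * real n"
      if "T \<in> \<T>" for T
      using T(3)[OF that] by linarith
    moreover have "xi T \<le> enat (D - 2)" if "T \<in> \<T>" for T
      using T(3)[OF that] xi_le by blast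
    moreover have "\<exists>T\<in>\<T>. 1 / 2 * log 2 (real n) \<le> real (length (advice T))"
      if "elects_in_time advice alg (D - 2) \<T>" for advice alg
      using D by (intro long_advice T(1) T(4)[OF that]) simp
    ultimately show "\<exists>\<T> :: nat port_graph set.
        \<T> \<noteq> {} \<and>
        (\<forall>T\<in>\<T>. port_tree T \<and>
          1 * real n \<le> real (card (nodes T)) \<and> real (card (nodes T)) \<le> 5 * real n \<and>
          diameter T = D \<and> xi T \<le> enat (D - 2)) \<and>
        (0 \<le> n \<longrightarrow>
          (\<forall>advice alg. elects_in_time advice alg (D - 2) \<T> \<longrightarrow>
            (\<exists>T\<in>\<T>. 1 / 2 * log 2 (real n) \<le> real (length (advice T)))))"
      using T(2,3) by (intro exI[of _ \<T>]) simp
  qed simp_all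
qed

end
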